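(* Let $i\ge 0$, let $K_1$ and $K_2$ be finite abstract simplicial complexes, each having at least one $i$-face, and let $K:=K_1\vee_iK_2$ be a combinatorial $i$-wedge sum of them. Let $\mu_1\le\cdots\le\mu_m$ be the eigenvalues of $\Delta_i^{up}(K_1\cup K_2)$, where $K_1\cup K_2$ is the disjoint union, and let $\lambda_1\le\cdots\le\lambda_{m-1}$ be the eigenvalues of $\Delta_i^{up}(K)$, with multiplicity. Then $$\mu_j\le\lambda_j\le\mu_{j+1}\qquad\text{for every }1\le j\le m-1.$$
   Context: Given $i$-faces $F_1=\{v_0,\dots,v_i\}$ of $K_1$ and $F_2=\{u_0,\dots,u_i\}$ of $K_2$, the combinatorial $i$-wedge sum $K_1\vee_iK_2$ is the simplicial complex obtained from the disjoint union of $K_1$ and $K_2$ by identifying $v_j$ with $u_j$ for $j=0,\dots,i$ (so $F_1$ is identified with $F_2$); its faces are exactly the images of faces of $K_1$ and of $K_2$. For a finite abstract simplicial complex $K$ (closed under inclusion, containing the empty face), $S_i(K)$ is the set of $i$-faces and $C^i(K,\mathbb{R})$ is the space of real functions on oriented $i$-faces that change sign when the orientation is reversed. The coboundary $\delta_i:C^i\to C^{i+1}$ is $(\delta_i f)([v_0,\dots,v_{i+1}])=\sum_{j}(-1)^j f([v_0,\dots,\hat v_j,\dots,v_{i+1}])$. A positive weight function $w$ on faces defines inner products $(f,g)_{C^i}=\sum_{F\in S_i(K)}w(F)f([F])g([F])$, with adjoint $\delta_i^*$. The degree of an $i$-face is $\deg F=\sum_{\bar F\in S_{i+1}(K),\,F\subset\bar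 F}w(\bar F)$. The normalized combinatorial Laplacian is $\Delta_i^{up}(K)=\delta_i^*\delta_i$ on $C^i(K,\mathbb{R})$ for the weight function with $w(F)=1$ for every facet (inclusion-maximal face) and $w(F)=\deg F$ for every other face. *)

theory Defs
  imports Complex_Main "HOL-Library.Function_Algebras" "HOL-Combinatorics.Permutations"
begin

section \<open>Finite abstract simplicial complexes\<close>

definition finite_abstract_complex :: "'a set set \<Rightarrow> bool" where
  "finite_abstract_complex K \<longleftrightarrow>
     finite K \<and> {} \<in> K \<and> (\<forall>F\<in>K. finite F \<and> (\<forall>G\<subseteq>F. G \<in> K))"

definition faces :: "nat \<Rightarrow> 'a set set \<Rightarrow> 'a set set" where
  "faces i K = {F \<in> K. finite F \<and> card F = Suc i}"

definition is_facet :: "'a set set \<Rightarrow> 'a set \<Rightarrow> bool" where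
  "is_facet K F \<longleftrightarrow> F \<in> K \<and> (\<forall>G\<in>K. \<not> F \<subset> G)"

definition ordered_faces :: "nat \<Rightarrow> 'a set set \<Rightarrow> 'a list set" where
  "ordered_faces i K = {l. distinct l \<and> set l \<in> faces i K}"

text \<open>On the sum type only the empty face is shared by the two copies.\<close>

definition disjoint_union :: "'a set set \<Rightarrow> 'b set set \<Rightarrow> ('a + 'b) set set" where
  "disjoint_union K1 K2 = (\<lambda>F. Inl ` F) ` K1 \<union> (\<lambda>F. Inr ` F) ` K2"

text \<open>
  The quotient map of the identification of \<open>vs ! j\<close> with \<open>us ! j\<close>: the class of these
  two vertices is represented by \<open>Inl (vs ! j)\<close>, every other vertex represents itself.
\<close>

definition glue :: "'a list \<Rightarrow> 'b list \<Rightarrow> 'a + 'b \<Rightarrow> 'a + 'b" where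
  "glue vs us x = (case x of
      Inl a \<Rightarrow> Inl a
    | Inr b \<Rightarrow> (case map_of (zip us vs) b of Some a \<Rightarrow> Inl a | None \<Rightarrow> Inr b))"

text \<open>
  The combinatorial \<open>i\<close>-wedge sum is the case in which \<open>vs\<close> and \<open>us\<close> are orderings of
  \<open>i\<close>-faces of \<open>K1\<close> and \<open>K2\<close>.
\<close>

definition wedge_sum :: "'a list \<Rightarrow> 'b list \<Rightarrow> 'a set set \<Rightarrow> 'b set set \<Rightarrow> ('a + 'b) set set" where
  "wedge_sum vs us K1 K2 = (\<lambda>F. glue vs us ` F) ` disjoint_union K1 K2"


section \<open>Cochains and the coboundary\<close>

text \<open>
  An oriented face \<open>[v\<^sub>0, \<dots>, v\<^sub>i]\<close> is an ordering of the face up to even permutations. A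
  function on oriented faces that changes sign with the orientation is therefore the same as
  an alternating function on orderings; it is extended by 0 to all other lists.
\<close>

definition cochains :: "nat \<Rightarrow> 'a set set \<Rightarrow> ('a list \<Rightarrow> real) set" where
  "cochains i K = {f.
     (\<forall>l. l \<notin> ordered_faces i K \<longrightarrow> f l = 0) \<and>
     (\<forall>l\<in>ordered_faces i K. \<forall>p. p permutes {..<length l} \<longrightarrow>
        f (permute_list p l) = of_int (sign p) * f l)}"

definition coboundary :: "nat \<Rightarrow> 'a set set \<Rightarrow> ('a list \<Rightarrow> real) \<Rightarrow> 'a list \<Rightarrow> real" where
  "coboundary i K f l =
     (if l \<in> ordered_faces (Suc i) K
      then \<Sum>j\<le>Suc i. (- 1) ^ j * f (take j l @ drop (Suc j) l) else 0)"


section \<open>Weights, inner products and the Laplacian\<close>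

definition face_degree :: "'a set set \<Rightarrow> ('a set \<Rightarrow> real) \<Rightarrow> 'a set \<Rightarrow> real" where
  "face_degree K w F = (\<Sum>G \<in> {G \<in> K. finite G \<and> card G = Suc (card F) \<and> F \<subset> G}. w G)"

text \<open>
  The weight in which facets have weight 1 and every other face has its degree as weight,
  computed by recursion from the facets downwards. The value 0 outside \<open>K\<close> (or for infinite
  \<open>K\<close>) is irrelevant.
\<close>

function normalized_weight :: "'a set set \<Rightarrow> 'a set \<Rightarrow> real" where
  "normalized_weight K F =
     (if infinite K \<or> F \<notin> K then 0
      else if is_facet K F then 1
      else (\<Sum>G \<in> {G \<in> K. finite G \<and> card G = Suc (card F) \<and> F \<subset> G}. normalized_weight K G))"
  by pat_completeness auto
termination
proof (relation "measure (\<lambda>(K, F). card {G \<in> K. F \<subset> G})")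
  fix K :: "'a set set" and F G
  assume "\<not> (infinite K \<or> F \<notin> K)"
    and "G \<in> {G \<in> K. finite G \<and> card G = Suc (card F) \<and> F \<subset> G}"
  then have "{H \<in> K. G \<subset> H} \<subset> {H \<in> K. F \<subset> H}" "finite {H \<in> K. F \<subset> H}"
    by auto
  then show "((K, G), (K, F)) \<in> measure (\<lambda>(K, F). card {G \<in> K. F \<subset> G})"
    by (simp add: psubset_card_mono)
qed simp

declare normalized_weight.simps [simp del]

lemma normalized_weight_facet:
  "finite K \<Longrightarrow> is_facet K F \<Longrightarrow> normalized_weight K F = 1"
  by (simp add: normalized_weight.simps [of K F] is_facet_def)

lemma normalized_weight_not_facet:
  "finite K \<Longrightarrow> F \<in> K \<Longrightarrow> \<not> is_facet K F \<Longrightarrow>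
    normalized_weight K F = face_degree K (normalized_weight K) F"
  by (simp add: normalized_weight.simps [of K F] face_degree_def)

text \<open>
  An arbitrary orientation of \<open>F\<close>; products of two cochain values do not depend on the choice.
\<close>

definition orient :: "'a set \<Rightarrow> 'a list" where
  "orient F = (SOME l. distinct l \<and> set l = F)"

definition cochain_inner ::
    "nat \<Rightarrow> 'a set set \<Rightarrow> ('a set \<Rightarrow> real) \<Rightarrow> ('a list \<Rightarrow> real) \<Rightarrow> ('a list \<Rightarrow> real) \<Rightarrow> real" where
  "cochain_inner i K w f g = (\<Sum>F\<in>faces i K. w F * f (orient F) * g (orient F))"

text \<open>
  The adjoint of the coboundary from \<open>i\<close>-cochains to \<open>(i+1)\<close>-cochains. For a positive weight
  on a finite complex it exists and is unique, as these spaces are finite-dimensional inner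
  product spaces.
\<close>

definition coboundary_adjoint ::
    "nat \<Rightarrow> 'a set set \<Rightarrow> ('a set \<Rightarrow> real) \<Rightarrow> ('a list \<Rightarrow> real) \<Rightarrow> 'a list \<Rightarrow> real" where
  "coboundary_adjoint i K w g =
     (THE h. h \<in> cochains i K \<and>
        (\<forall>f\<in>cochains i K. cochain_inner (Suc i) K w (coboundary i K f) g = cochain_inner i K w f h))"

definition up_laplacian ::
    "nat \<Rightarrow> 'a set set \<Rightarrow> ('a set \<Rightarrow> real) \<Rightarrow> ('a list \<Rightarrow> real) \<Rightarrow> 'a list \<Rightarrow> real" where
  "up_laplacian i K w f = coboundary_adjoint i K w (coboundary i K f)"

definition normalized_up_laplacian ::
    "nat \<Rightarrow> 'a set set \<Rightarrow> ('a list \<Rightarrow> real) \<Rightarrow> 'a list \<Rightarrow> real" where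
  "normalized_up_laplacian i K = up_laplacian i K (normalized_weight K)"


section \<open>Eigenvalues with multiplicity\<close>

definition fun_scale :: "real \<Rightarrow> ('b \<Rightarrow> real) \<Rightarrow> 'b \<Rightarrow> real" where
  "fun_scale c f = (\<lambda>x. c * f x)"

interpretation fun_space: vector_space "fun_scale :: real \<Rightarrow> ('b \<Rightarrow> real) \<Rightarrow> 'b \<Rightarrow> real"
  by unfold_locales (auto simp: fun_scale_def fun_eq_iff algebra_simps)

definition eigenspace :: "('b \<Rightarrow> real) set \<Rightarrow> (('b \<Rightarrow> real) \<Rightarrow> 'b \<Rightarrow> real) \<Rightarrow> real \<Rightarrow> ('b \<Rightarrow> real) set" where
  "eigenspace V T x = {f \<in> V. T f = fun_scale x f}"

definition eigenvalues :: "('b \<Rightarrow> real) set \<Rightarrow> (('b \<Rightarrow> real) \<Rightarrow> 'b \<Rightarrow> real) \<Rightarrow> real set" where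
  "eigenvalues V T = {x. \<exists>f\<in>V. f \<noteq> 0 \<and> T f = fun_scale x f}"

text \<open>
  The nondecreasing list of the eigenvalues, each repeated according to the dimension of its
  eigenspace. For an operator that is self-adjoint on a finite-dimensional inner product space,
  such as the Laplacian, this is also the algebraic multiplicity.
\<close>

definition eigenvalue_list :: "('b \<Rightarrow> real) set \<Rightarrow> (('b \<Rightarrow> real) \<Rightarrow> 'b \<Rightarrow> real) \<Rightarrow> real list" where
  "eigenvalue_list V T =
     concat (map (\<lambda>x. replicate (fun_space.dim (eigenspace V T x)) x)
       (sorted_list_of_set (eigenvalues V T)))"

definition up_spectrum :: "nat \<Rightarrow> 'a set set \<Rightarrow> real list" where
  "up_spectrum i K = eigenvalue_list (cochains i K) (normalized_up_laplacian i K)"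

end

theory Submission
  imports Defs "Jordan_Normal_Form.Char_Poly"
begin

text \<open>
  Let \<open>D\<close> be the disjoint union. Pulling cochains back along the quotient map embeds
  \<open>C\<^sup>i(K)\<close> in \<open>C\<^sup>i(D)\<close> with codimension 1. Faces of dimension greater than \<open>i\<close> and their weights are
  unaffected by the identification, so \<open>\<parallel>\<delta>f\<parallel>\<close> is preserved. If neither of the two identified
  faces is a facet, their weights add up in \<open>K\<close>, so \<open>\<parallel>f\<parallel>\<close> is preserved as well. If one of them is a facet,
  its weight 1 disappears in \<open>K\<close> instead of being added to the weight of the other one, but the
  coboundary ignores it; setting the pullback to 0 there keeps the embedding isometric.
  Cauchy interlacing follows by counting dimensions: the span of the eigenvectors of
  \<open>K\<close> with eigenvalue at most \<open>x\<close> meets the span of those of \<open>D\<close> with eigenvalue above \<open>x\<close>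
  only in 0, and likewise with the roles of the two exchanged.
\<close>

section \<open>Symmetric operators on finite-dimensional function spaces\<close>

text \<open>The weight of a face is computed from the faces above it, and the operator involves only
  the dimensions i and i+1. The identification also merges lower-dimensional faces of the two glued
  faces, and weights may change there, but the operator does not see this. So only faces with at
  least i+1 vertices have to be controlled, and among them the quotient map merges exactly one pair.
  The coboundary ignores a facet of dimension i because no (i+1)-face contains it. The counting
  argument compares quadratic forms only: on both sides the form of the Laplacian is the squared
  norm of the coboundary, so the embedding need not commute with the two Laplacians. The eigenvalue
  lists are built from real eigenspaces and must be tied to an orthogonal basis of eigenvectors
  before anything can be counted; complex numbers enter solely to produce one eigenvector in an
  invariant subspace.\<close>

lemma sorted_eigenvalue_list: "sorted (eigenvalue_list V T)"
proof -
  have "sorted (concat (map (\<lambda>x. replicate (n x) x) xs))" if "sorted xs" for n and xs :: "real list"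
    using that by (induction xs) (auto simp: sorted_append)
  then show ?thesis
    by (simp add: eigenvalue_list_def)
qed

text \<open>The form \<open>ip\<close> is bilinear on all functions but definite only on
  \<open>V\<close>: the cochain inner product reads a function at one ordering of each face and
  misses everything else. Linearity of \<open>T\<close> is not among the axioms, since the Laplacian
  comes from a definite description; symmetry yields it.\<close>

locale symmetric_operator =
  fixes V :: "('b \<Rightarrow> real) set"
    and ip :: "('b \<Rightarrow> real) \<Rightarrow> ('b \<Rightarrow> real) \<Rightarrow> real"
    and T :: "('b \<Rightarrow> real) \<Rightarrow> 'b \<Rightarrow> real"
  assumes subspace_V: "fun_space.subspace V"
    and finite_dim: "\<exists>S. finite S \<and> V \<subseteq> fun_space.span S"
    and ip_add: "ip (f + g) h = ip f h + ip g h"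
    and ip_scale: "ip (fun_scale c f) h = c * ip f h"
    and ip_sym: "ip f g = ip g f"
    and ip_pos: "f \<in> V \<Longrightarrow> f \<noteq> 0 \<Longrightarrow> 0 < ip f f"
    and T_closed: "f \<in> V \<Longrightarrow> T f \<in> V"
    and T_sym: "f \<in> V \<Longrightarrow> g \<in> V \<Longrightarrow> ip f (T g) = ip (T f) g"
begin

lemma ip_add_right: "ip h (f + g) = ip h f + ip h g"
  by (metis ip_add ip_sym)

lemma ip_scale_right: "ip h (fun_scale c f) = c * ip h f"
  by (metis ip_scale ip_sym)

lemma ip_zero [simp]: "ip 0 h = 0" "ip h 0 = 0"
  using ip_scale[of 0 0 h] ip_scale_right[of h 0 0] by simp_all

lemma ip_diff: "ip (f - g) h = ip f h - ip g h"
  using ip_add[of "f - g" g h] by simp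

lemma ip_diff_right: "ip h (f - g) = ip h f - ip h g"
  by (metis ip_diff ip_sym)

lemma ip_sum: "ip (\<Sum>x\<in>A. f x) h = (\<Sum>x\<in>A. ip (f x) h)"
  by (induction A rule: infinite_finite_induct) (simp_all add: ip_add del: plus_fun_apply zero_fun_apply)

lemma ip_sum_right: "ip h (\<Sum>x\<in>A. f x) = (\<Sum>x\<in>A. ip h (f x))"
  by (simp add: ip_sym[of h] ip_sum)

lemma ip_self_eq_0D: "f \<in> V \<Longrightarrow> ip f f = 0 \<Longrightarrow> f = 0"
  using ip_pos by fastforce

lemma ip_nonneg: "f \<in> V \<Longrightarrow> 0 \<le> ip f f"
  using ip_pos by (cases "f = 0") (auto intro: less_imp_le)

lemma ip_eqI:
  assumes "g \<in> V" "h \<in> V" "\<And>f. f \<in> V \<Longrightarrow> ip f g = ip f h"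
  shows "g = h"
proof -
  have "g - h \<in> V"
    using assms fun_space.subspace_diff[OF subspace_V] by blast
  then have "g - h = 0"
    by (intro ip_self_eq_0D) (auto simp: ip_diff_right assms)
  then show ?thesis by simp
qed

lemmas V_closed = fun_space.subspace_add[OF subspace_V] fun_space.subspace_scale[OF subspace_V]
  fun_space.subspace_0[OF subspace_V] fun_space.subspace_sum[OF subspace_V]
  fun_space.subspace_diff[OF subspace_V]

text \<open>Symmetry moves \<open>T\<close> to the other argument, where additivity is that of
  \<open>ip\<close>; elements of \<open>V\<close> are determined by their inner products with
  \<open>V\<close>.\<close>

lemma T_add: "f \<in> V \<Longrightarrow> g \<in> V \<Longrightarrow> T (f + g) = T f + T g"
  by (rule ip_eqI) (auto simp: T_sym ip_add_right V_closed T_closed)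

lemma T_scale: "f \<in> V \<Longrightarrow> T (fun_scale c f) = fun_scale c (T f)"
  by (rule ip_eqI) (auto simp: T_sym ip_scale_right V_closed T_closed)

lemma T_zero: "T 0 = 0"
  using T_scale[of 0 0] V_closed(3) by simp

lemma T_sum: "(\<And>x. x \<in> A \<Longrightarrow> f x \<in> V) \<Longrightarrow> T (\<Sum>x\<in>A. f x) = (\<Sum>x\<in>A. T (f x))"
  by (induction A rule: infinite_finite_induct) (auto simp: T_add T_zero V_closed simp del: plus_fun_apply zero_fun_apply)

lemma T_lincomb:
  "(\<And>x. x \<in> A \<Longrightarrow> f x \<in> V) \<Longrightarrow> T (\<Sum>x\<in>A. fun_scale (c x) (f x)) = (\<Sum>x\<in>A. fun_scale (c x) (T (f x)))"
  by (simp add: T_sum T_scale V_closed)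

lemma finite_basis_subspace:
  assumes "U \<subseteq> V"
  obtains B where "finite B" "B \<subseteq> U" "fun_space.independent B" "U \<subseteq> fun_space.span B"
proof -
  obtain B where B: "B \<subseteq> U" "fun_space.independent B" "U \<subseteq> fun_space.span B"
    using fun_space.maximal_independent_subset by blast
  obtain S where "finite S" "V \<subseteq> fun_space.span S"
    using finite_dim by blast
  then have "finite B"
    using fun_space.independent_span_bound[of S B] B assms by blast
  then show thesis
    using B that by blast
qed

text \<open>
  If \<open>X + \<i> Y\<close> is a complex eigenvector for \<open>a + \<i> b\<close>, then symmetry of \<open>T\<close> applied to the
  pair \<open>X\<close>, \<open>Y\<close> forces \<open>b (|X|\<^sup>2 + |Y|\<^sup>2) = 0\<close>.
\<close>

lemma eigenvector_exists:
  assumes U: "fun_space.subspace U" "U \<subseteq> V" and inv: "\<And>f. f \<in> U \<Longrightarrow> T f \<in> U"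
    and ne: "\<exists>f\<in>U. f \<noteq> 0"
  shows "\<exists>f\<in>U. f \<noteq> 0 \<and> (\<exists>x. T f = fun_scale x f)"
proof -
  obtain B where B: "finite B" "B \<subseteq> U" "fun_space.independent B" "U \<subseteq> fun_space.span B"
    using finite_basis_subspace[OF U(2)] .
  define n where "n = card B"
  have "n > 0"
    unfolding n_def using ne B(1,4) by (auto simp: card_gt_0_iff)
  obtain b where b: "bij_betw b {..<n} B"
    using ex_bij_betw_nat_finite[OF B(1)] by (auto simp: n_def atLeast0LessThan)
  have sum_b: "(\<Sum>v\<in>B. g v) = (\<Sum>k<n. g (b k))" for g :: "('b \<Rightarrow> real) \<Rightarrow> ('b \<Rightarrow> real)"
    by (rule sum.reindex_bij_betw[OF b, symmetric])
  have bU: "b k \<in> U" if "k < n" for k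
    using that b B(2) by (auto dest: bij_betwE)
  have "\<exists>c. T (b j) = (\<Sum>k<n. fun_scale (c k) (b k))" if "j < n" for j
  proof -
    have "T (b j) \<in> fun_space.span B"
      using inv bU B(4) that by blast
    then obtain u where "T (b j) = (\<Sum>v\<in>B. fun_scale (u v) v)"
      using fun_space.span_finite[OF B(1)] by auto
    then show ?thesis
      by (auto simp: sum_b)
  qed
  then obtain a where a: "\<And>j. j < n \<Longrightarrow> T (b j) = (\<Sum>k<n. fun_scale (a j k) (b k))"
    by metis
  \<comment> \<open>The matrix of \<open>T\<close> on \<open>U\<close> in the basis
    \<open>b\<close>, with the coefficients of \<open>T (b j)\<close> in column j. It is read over
    the complex numbers so that its characteristic polynomial has a root.\<close>
  define A where "A = mat n n (\<lambda>(k, j). complex_of_real (a j k))"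
  have A: "A \<in> carrier_mat n n"
    by (simp add: A_def)
  have "\<not> constant (poly (char_poly A))"
    using degree_monic_char_poly[OF A] \<open>n > 0\<close> by (simp add: constant_degree)
  then obtain z where "poly (char_poly A) z = 0"
    using fundamental_theorem_of_algebra by blast
  then have "eigenvalue A z"
    using eigenvalue_root_char_poly[OF A] by simp
  then obtain w where w: "w \<in> carrier_vec n" "w \<noteq> 0\<^sub>v n" "A *\<^sub>v w = z \<cdot>\<^sub>v w"
    using A unfolding eigenvalue_def eigenvector_def by auto
  have comp: "(\<Sum>j<n. complex_of_real (a j k) * w $ j) = z * w $ k" if "k < n" for k
  proof -
    have "(A *\<^sub>v w) $ k = (\<Sum>j<n. complex_of_real (a j k) * w $ j)"
      using that w(1) by (simp add: A_def scalar_prod_def atLeast0LessThan)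
    then show ?thesis
      using that w(1,3) by simp
  qed
  \<comment> \<open>Real and imaginary part of the eigenvector with coordinates \<open>w\<close>.
    Once the eigenvalue is known to be real, whichever of them is nonzero is the vector
    sought.\<close>
  define X where "X = (\<Sum>k<n. fun_scale (Re (w $ k)) (b k))"
  define Y where "Y = (\<Sum>k<n. fun_scale (Im (w $ k)) (b k))"
  have XU: "X \<in> U" and YU: "Y \<in> U"
    unfolding X_def Y_def
    by (auto intro!: fun_space.subspace_sum[OF U(1)] fun_space.subspace_scale[OF U(1)] bU)
  have XV: "X \<in> V" and YV: "Y \<in> V"
    using XU YU U(2) by auto
  have T_comb: "T (\<Sum>j<n. fun_scale (c j) (b j)) = (\<Sum>k<n. fun_scale (\<Sum>j<n. a j k * c j) (b k))" for c
  proof -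
    have "T (\<Sum>j<n. fun_scale (c j) (b j)) = (\<Sum>j<n. fun_scale (c j) (T (b j)))"
      using bU U(2) by (intro T_lincomb) auto
    also have "\<dots> = (\<Sum>j<n. \<Sum>k<n. fun_scale (a j k * c j) (b k))"
      by (simp add: a fun_space.scale_sum_right mult.commute)
    also have "\<dots> = (\<Sum>k<n. fun_scale (\<Sum>j<n. a j k * c j) (b k))"
      by (subst sum.swap) (simp add: fun_space.scale_sum_left)
    finally show ?thesis .
  qed
  have re: "(\<Sum>j<n. a j k * Re (w $ j)) = Re z * Re (w $ k) - Im z * Im (w $ k)" if "k < n" for k
    using arg_cong[OF comp[OF that], of Re] by simp
  have im: "(\<Sum>j<n. a j k * Im (w $ j)) = Re z * Im (w $ k) + Im z * Re (w $ k)" if "k < n" for k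
    using arg_cong[OF comp[OF that], of Im] by simp
  have TX: "T X = fun_scale (Re z) X - fun_scale (Im z) Y"
    unfolding X_def Y_def T_comb
    by (simp add: re fun_space.scale_sum_right fun_space.scale_left_diff_distrib sum_subtractf)
  have TY: "T Y = fun_scale (Re z) Y + fun_scale (Im z) X"
    unfolding X_def Y_def T_comb
    by (simp add: im fun_space.scale_sum_right fun_space.scale_left_distrib sum.distrib)
  have "\<exists>k<n. w $ k \<noteq> 0"
    using w(1,2) by (metis eq_vecI carrier_vecD index_zero_vec)
  then obtain k where k: "k < n" "w $ k \<noteq> 0"
    by blast
  have indep: "c k = 0" if "(\<Sum>j<n. fun_scale (c j) (b j)) = 0" for c
  proof -
    have "(\<Sum>v\<in>B. fun_scale (c (inv_into {..<n} b v)) v) = 0"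
      using that bij_betw_inv_into_left[OF b] by (simp add: sum_b)
    moreover have "b k \<in> B"
      using k(1) b by (auto dest: bij_betwE)
    ultimately have "c (inv_into {..<n} b (b k)) = 0"
      by (rule fun_space.independentD[OF B(3) B(1) subset_refl])
    then show ?thesis
      using bij_betw_inv_into_left[OF b] k(1) by simp
  qed
  have XY: "X \<noteq> 0 \<or> Y \<noteq> 0"
    using indep[of "\<lambda>j. Re (w $ j)"] indep[of "\<lambda>j. Im (w $ j)"] k(2)
    by (auto simp: X_def Y_def complex_eq_iff)
  have "ip X (T Y) = ip (T X) Y"
    by (rule T_sym[OF XV YV])
  then have "Im z * (ip X X + ip Y Y) = 0"
    by (simp add: TX TY ip_diff ip_add_right ip_scale ip_scale_right algebra_simps)
  moreover have "ip X X + ip Y Y > 0"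
    using XY ip_pos[OF XV] ip_pos[OF YV] ip_nonneg[OF XV] ip_nonneg[OF YV] by fastforce
  ultimately have "Im z = 0"
    by simp
  then have "T X = fun_scale (Re z) X" "T Y = fun_scale (Re z) Y"
    using TX TY by simp_all
  then show ?thesis
    using XY XU YU by blast
qed

section \<open>Orthogonal systems of eigenvectors and the spectral theorem\<close>

definition orthogonal_eigenvectors :: "('b \<Rightarrow> real) set \<Rightarrow> bool" where
  "orthogonal_eigenvectors B \<longleftrightarrow> finite B \<and> B \<subseteq> V \<and> 0 \<notin> B \<and>
     (\<forall>b\<in>B. \<forall>c\<in>B. b \<noteq> c \<longrightarrow> ip b c = 0) \<and> (\<forall>b\<in>B. \<exists>x. T b = fun_scale x b)"

text \<open>On an eigenvector this quotient is its eigenvalue, so it serves as the function from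
  eigenvectors to eigenvalues.\<close>

definition rayleigh :: "('b \<Rightarrow> real) \<Rightarrow> real" where
  "rayleigh f = ip f (T f) / ip f f"

context
  fixes B assumes B: "orthogonal_eigenvectors B"
begin

lemma finite_B: "finite B" and B_subset: "B \<subseteq> V" and B_nonzero: "0 \<notin> B"
  and B_orth: "b \<in> B \<Longrightarrow> c \<in> B \<Longrightarrow> b \<noteq> c \<Longrightarrow> ip b c = 0"
  using B by (auto simp: orthogonal_eigenvectors_def)

lemma B_pos: "b \<in> B \<Longrightarrow> 0 < ip b b"
  using ip_pos B_subset B_nonzero by blast

lemma T_eigenvector:
  assumes "b \<in> B" shows "T b = fun_scale (rayleigh b) b"
proof -
  obtain x where "T b = fun_scale x b"
    using B assms unfolding orthogonal_eigenvectors_def by blast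
  moreover from this have "rayleigh b = x"
    using B_pos[OF assms] by (simp add: rayleigh_def ip_scale_right)
  ultimately show ?thesis by simp
qed

lemma ip_lincomb:
  assumes "C \<subseteq> B" "b \<in> C"
  shows "ip (\<Sum>c\<in>C. fun_scale (u c) c) b = u b * ip b b"
proof -
  have "ip (\<Sum>c\<in>C. fun_scale (u c) c) b = (\<Sum>c\<in>C. if c = b then u b * ip b b else 0)"
    unfolding ip_sum ip_scale using assms B_orth by (intro sum.cong) auto
  then show ?thesis
    using assms finite_subset[OF _ finite_B] by simp
qed

lemma orth_independent: "fun_space.independent B"
proof (rule fun_space.independent_if_scalars_zero[OF finite_B])
  fix u b assume "(\<Sum>c\<in>B. fun_scale (u c) c) = 0" "b \<in> B"
  then have "u b * ip b b = 0"
    using ip_lincomb[of B b u] by simp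
  then show "u b = 0"
    using B_pos[OF \<open>b \<in> B\<close>] by simp
qed

text \<open>Fourier expansion; the vectors are orthogonal but not normalised, hence the
  denominators.\<close>

lemma span_expand:
  assumes "C \<subseteq> B" "f \<in> fun_space.span C"
  shows "f = (\<Sum>b\<in>C. fun_scale (ip f b / ip b b) b)"
proof -
  have "finite C" using assms(1) finite_B by (rule finite_subset)
  then obtain u where u: "f = (\<Sum>c\<in>C. fun_scale (u c) c)"
    using fun_space.span_finite assms(2) by auto
  have "u b = ip f b / ip b b" if "b \<in> C" for b
    using ip_lincomb[OF assms(1) that, of u] B_pos[of b] that assms(1) by (auto simp: u)
  then have "(\<Sum>b\<in>C. fun_scale (ip f b / ip b b) b) = (\<Sum>c\<in>C. fun_scale (u c) c)"
    by (intro sum.cong) auto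
  then show ?thesis
    by (simp only: u)
qed

text \<open>Parseval's identity and its analogue for the form of \<open>T\<close>: eigenvectors
  diagonalise both, so on a span the Rayleigh quotient is a weighted mean of the eigenvalues
  involved.\<close>

lemma
  assumes "C \<subseteq> B" "f \<in> fun_space.span C"
  shows ip_expand: "ip f f = (\<Sum>b\<in>C. (ip f b)\<^sup>2 / ip b b)"
    and ip_T_expand: "ip f (T f) = (\<Sum>b\<in>C. rayleigh b * ((ip f b)\<^sup>2 / ip b b))"
proof -
  note f = span_expand[OF assms]
  have "ip f f = ip f (\<Sum>b\<in>C. fun_scale (ip f b / ip b b) b)"
    using f by simp
  then show "ip f f = (\<Sum>b\<in>C. (ip f b)\<^sup>2 / ip b b)"
    by (simp add: ip_sum_right ip_scale_right power2_eq_square)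
  have "T f = T (\<Sum>b\<in>C. fun_scale (ip f b / ip b b) b)"
    using f by simp
  also have "\<dots> = (\<Sum>b\<in>C. fun_scale (ip f b / ip b b) (T b))"
    using assms(1) B_subset by (intro T_lincomb) auto
  also have "\<dots> = (\<Sum>b\<in>C. fun_scale (ip f b / ip b b) (fun_scale (rayleigh b) b))"
    using assms(1) T_eigenvector by (intro sum.cong) (auto simp del: fun_space.scale_scale)
  finally show "ip f (T f) = (\<Sum>b\<in>C. rayleigh b * ((ip f b)\<^sup>2 / ip b b))"
    by (simp add: ip_sum_right ip_scale_right power2_eq_square algebra_simps)
qed

lemma span_subset_V: "C \<subseteq> B \<Longrightarrow> fun_space.span C \<subseteq> V"
  using B_subset fun_space.span_minimal[OF _ subspace_V] by blast

lemma rayleigh_le_on_span: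
  assumes C: "C \<subseteq> B" "f \<in> fun_space.span C" and "\<And>b. b \<in> C \<Longrightarrow> rayleigh b \<le> x"
  shows "ip f (T f) \<le> x * ip f f"
  unfolding ip_expand[OF C] ip_T_expand[OF C] sum_distrib_left
  using assms B_pos by (intro sum_mono mult_right_mono) (auto simp: less_imp_le subset_iff)

lemma rayleigh_gt_on_span:
  assumes C: "C \<subseteq> B" "f \<in> fun_space.span C" and gt: "\<And>b. b \<in> C \<Longrightarrow> x < rayleigh b" and "f \<noteq> 0"
  shows "x * ip f f < ip f (T f)"
proof -
  \<comment> \<open>One nonzero coefficient is enough to make the termwise comparison of the two
    expansions strict.\<close>
  have "\<exists>b\<in>C. ip f b \<noteq> 0"
  proof (rule ccontr)
    assume "\<not> ?thesis"
    then have "f = 0"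
      using span_expand[OF C] by simp
    with \<open>f \<noteq> 0\<close> show False by simp
  qed
  then obtain b where b: "b \<in> C" "ip f b \<noteq> 0" by blast
  have pos: "0 < ip c c" if "c \<in> C" for c
    using B_pos C(1) that by blast
  show ?thesis
    unfolding ip_expand[OF C] ip_T_expand[OF C] sum_distrib_left
  proof (rule sum_strict_mono_ex1)
    show "finite C" using C(1) finite_B by (rule finite_subset)
    show "\<forall>c\<in>C. x * ((ip f c)\<^sup>2 / ip c c) \<le> rayleigh c * ((ip f c)\<^sup>2 / ip c c)"
      using gt pos by (intro ballI mult_right_mono) (auto simp: less_imp_le)
    show "\<exists>c\<in>C. x * ((ip f c)\<^sup>2 / ip c c) < rayleigh c * ((ip f c)\<^sup>2 / ip c c)"
      using gt pos b by (intro bexI[of _ b] mult_strict_right_mono) auto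
  qed
qed

end

text \<open>Independence bounds the size of an orthogonal system of eigenvectors, so a largest one
  exists. If it did not span \<open>V\<close>, its orthogonal complement would be a nonzero
  \<open>T\<close>-invariant subspace and would contribute a further eigenvector.\<close>

lemma eigenbasis_exists:
  obtains B where "orthogonal_eigenvectors B" "fun_space.span B = V"
proof -
  obtain S where S: "finite S" "V \<subseteq> fun_space.span S"
    using finite_dim by blast
  have bound: "card B \<le> card S" if "orthogonal_eigenvectors B" for B
    using fun_space.independent_span_bound[OF S(1) orth_independent[OF that]] B_subset[OF that] S(2)
    by blast
  have "orthogonal_eigenvectors {}"
    by (simp add: orthogonal_eigenvectors_def)
  then obtain B where B: "orthogonal_eigenvectors B"
    and max: "\<And>C. orthogonal_eigenvectors C \<Longrightarrow> card C \<le> card B"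
    using ex_has_greatest_nat[of orthogonal_eigenvectors "{}" card "Suc (card S)"] bound
    by (metis le_imp_less_Suc)
  define U where "U = {f \<in> V. \<forall>b\<in>B. ip f b = 0}"
  have "V \<subseteq> fun_space.span B"
  proof (rule ccontr)
    assume "\<not> V \<subseteq> fun_space.span B"
    then obtain f where f: "f \<in> V" "f \<notin> fun_space.span B" by blast
    \<comment> \<open>The orthogonal projection of \<open>f\<close> to the span of \<open>B\<close>;
      the remainder \<open>f - p\<close> shows that the complement \<open>U\<close> is not
      0.\<close>
    define p where "p = (\<Sum>b\<in>B. fun_scale (ip f b / ip b b) b)"
    have p: "p \<in> fun_space.span B"
      unfolding p_def
      by (intro fun_space.span_sum fun_space.span_scale fun_space.span_base)
    then have "p \<in> V"
      using span_subset_V[OF B subset_refl] by blast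
    have "ip p b = ip f b" if "b \<in> B" for b
      unfolding p_def using ip_lincomb[OF B subset_refl that] B_pos[OF B that] by simp
    then have "f - p \<in> U"
      using f(1) \<open>p \<in> V\<close> by (simp add: U_def ip_diff V_closed)
    moreover have "f - p \<noteq> 0"
      using f(2) p by auto
    moreover have "fun_space.subspace U"
      unfolding U_def fun_space.subspace_def by (auto simp: ip_add ip_scale V_closed)
    moreover have "T g \<in> U" if "g \<in> U" for g
    proof -
      have "ip (T g) b = 0" if "b \<in> B" for b
        using T_sym[of g b] T_eigenvector[OF B that] B_subset[OF B] that \<open>g \<in> U\<close>
        by (auto simp: U_def ip_scale_right)
      then show ?thesis
        using that T_closed by (auto simp: U_def)
    qed
    ultimately obtain e x where e: "e \<in> U" "e \<noteq> 0" "T e = fun_scale x e"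
      using eigenvector_exists[of U] unfolding U_def by blast
    have "e \<notin> B"
      using e(1,2) ip_pos[of e] by (auto simp: U_def)
    have "e \<in> V" "\<And>b. b \<in> B \<Longrightarrow> ip e b = 0" "\<And>b. b \<in> B \<Longrightarrow> ip b e = 0"
      using e(1) ip_sym[of e] by (auto simp: U_def)
    moreover have "\<exists>x. T b = fun_scale x b" if "b \<in> insert e B" for b
      using that e(3) T_eigenvector[OF B] by blast
    ultimately have "orthogonal_eigenvectors (insert e B)"
      using finite_B[OF B] B_subset[OF B] B_nonzero[OF B] B_orth[OF B] e(2)
      unfolding orthogonal_eigenvectors_def by simp
    then have "card (insert e B) \<le> card B"
      by (rule max)
    then show False
      using \<open>e \<notin> B\<close> finite_B[OF B] by simp
  qed
  then show thesis
    using that B span_subset_V[OF B subset_refl] by blast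
qed

section \<open>Eigenspaces and multiplicities read off an eigenbasis\<close>

context
  fixes B assumes B: "orthogonal_eigenvectors B" and span_B: "fun_space.span B = V"
begin

lemma card_eigenbasis: "fun_space.independent C \<Longrightarrow> fun_space.span C = V \<Longrightarrow> card B = card C"
  using orth_independent[OF B] span_B fun_space.dim_eq_card by metis

text \<open>By symmetry an eigenvector for \<open>x\<close> is orthogonal to every basis vector with
  another eigenvalue, so these drop out of its expansion.\<close>

lemma eigenspace_eq: "eigenspace V T x = fun_space.span {b \<in> B. rayleigh b = x}"
proof
  show "eigenspace V T x \<subseteq> fun_space.span {b \<in> B. rayleigh b = x}"
  proof
    fix f assume "f \<in> eigenspace V T x"
    then have f: "f \<in> V" "T f = fun_scale x f"
      by (auto simp: eigenspace_def)
    have zero: "ip f b = 0" if "b \<in> B" "rayleigh b \<noteq> x" for b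
    proof -
      have "ip f (T b) = ip (T f) b"
        using T_sym f(1) B_subset[OF B] that(1) by blast
      then show ?thesis
        using T_eigenvector[OF B that(1)] that(2) by (simp add: f(2) ip_scale ip_scale_right)
    qed
    have "f = (\<Sum>b\<in>B. fun_scale (ip f b / ip b b) b)"
      using span_expand[OF B subset_refl] f(1) span_B by blast
    also have "\<dots> = (\<Sum>b\<in>{b \<in> B. rayleigh b = x}. fun_scale (ip f b / ip b b) b)"
      using finite_B[OF B] zero by (intro sum.mono_neutral_right) auto
    also have "\<dots> \<in> fun_space.span {b \<in> B. rayleigh b = x}"
      by (intro fun_space.span_sum fun_space.span_scale fun_space.span_base)
    finally show "f \<in> fun_space.span {b \<in> B. rayleigh b = x}" .
  qed
  show "fun_space.span {b \<in> B. rayleigh b = x} \<subseteq> eigenspace V T x"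
  proof (rule fun_space.span_minimal)
    show "{b \<in> B. rayleigh b = x} \<subseteq> eigenspace V T x"
      using B_subset[OF B] T_eigenvector[OF B] by (auto simp: eigenspace_def)
    show "fun_space.subspace (eigenspace V T x)"
      unfolding eigenspace_def fun_space.subspace_def
      by (auto simp: V_closed T_zero T_add T_scale fun_space.scale_right_distrib mult.commute)
  qed
qed

lemma dim_eigenspace: "fun_space.dim (eigenspace V T x) = card {b \<in> B. rayleigh b = x}"
  unfolding eigenspace_eq
  by (rule fun_space.dim_span_eq_card_independent[OF fun_space.independent_mono[OF orth_independent[OF B]]])
    blast

lemma eigenvalues_eq: "eigenvalues V T = rayleigh ` B"
proof
  show "rayleigh ` B \<subseteq> eigenvalues V T"
  proof (rule image_subsetI)
    fix b assume "b \<in> B"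
    then show "rayleigh b \<in> eigenvalues V T"
      unfolding eigenvalues_def using B_subset[OF B] B_nonzero[OF B] T_eigenvector[OF B]
      by (intro CollectI bexI[of _ b] conjI) auto
  qed
  show "eigenvalues V T \<subseteq> rayleigh ` B"
  proof
    fix x assume "x \<in> eigenvalues V T"
    then obtain f where f: "f \<in> fun_space.span {b \<in> B. rayleigh b = x}" "f \<noteq> 0"
      unfolding eigenvalues_def eigenspace_eq[symmetric] eigenspace_def by blast
    have "{b \<in> B. rayleigh b = x} \<noteq> {}"
      using f fun_space.span_empty by (metis singletonD)
    then show "x \<in> rayleigh ` B" by blast
  qed
qed

text \<open>The basis vectors with eigenvalue \<open>x\<close> are as many as the copies of
  \<open>x\<close> in the list, and these classes partition the basis. Together with sortedness,
  such counts are all that the interlacing argument knows about the list.\<close>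

lemma length_filter_eigenvalue_list:
  "length (filter P (eigenvalue_list V T)) = card {b \<in> B. P (rayleigh b)}"
proof -
  let ?E = "eigenvalues V T"
  have fin: "finite ?E"
    by (simp add: eigenvalues_eq finite_B[OF B])
  have "length (filter P (eigenvalue_list V T))
      = (\<Sum>x\<leftarrow>sorted_list_of_set ?E. if P x then card {b \<in> B. rayleigh b = x} else 0)"
    by (simp add: eigenvalue_list_def filter_concat length_concat dim_eigenspace o_def filter_replicate
        if_distrib[of length] cong: if_cong)
  also have "\<dots> = (\<Sum>x\<in>?E. if P x then card {b \<in> B. rayleigh b = x} else 0)"
    using fin by (simp add: sum_list_distinct_conv_sum_set)
  also have "\<dots> = (\<Sum>x\<in>?E. card {b \<in> {b \<in> B. P (rayleigh b)}. rayleigh b = x})"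
    by (intro sum.cong) (auto intro!: arg_cong[where f = card] simp: card_eq_0_iff)
  also have "\<dots> = card {b \<in> B. P (rayleigh b)}"
    using fin finite_B[OF B] by (subst card_UN_disjoint[symmetric])
      (auto simp: eigenvalues_eq intro!: arg_cong[where f = card])
  finally show ?thesis .
qed

lemma length_eigenvalue_list: "length (eigenvalue_list V T) = card B"
  using length_filter_eigenvalue_list[of "\<lambda>_. True"] by simp

end

end

section \<open>Interlacing\<close>

text \<open>The entries at most \<open>x\<close> form a prefix of a sorted list, so their number
  tells which positions they occupy.\<close>

lemma sorted_nth_le_iff:
  fixes x :: "'a::linorder"
  assumes "sorted xs" "j < length xs"
  shows "xs ! j \<le> x \<longleftrightarrow> j < length (filter (\<lambda>y. y \<le> x) xs)"
  using assms
proof (induction xs arbitrary: j)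
  case (Cons y xs)
  show ?case
  proof (cases "y \<le> x")
    case True
    then show ?thesis using Cons by (cases j) auto
  next
    case False
    have "y \<le> z" if "z \<in> set (y # xs)" for z
      using Cons.prems(1) that by auto
    then have "filter (\<lambda>y. y \<le> x) (y # xs) = []" and "\<not> (y # xs) ! j \<le> x"
      using False Cons.prems(2) nth_mem[of j "y # xs"] order_trans unfolding filter_empty_conv by blast+
    then show ?thesis by simp
  qed
qed simp

text \<open>The two inequalities come from evaluating the counts at \<open>x = ys ! j\<close> and at
  \<open>x = xs ! Suc j\<close>.\<close>

lemma interlacing_if_counts:
  fixes xs ys :: "'a::linorder list"
  assumes "sorted xs" "sorted ys" "length xs = Suc (length ys)" "j < length ys"
    and "\<And>x. length (filter (\<lambda>z. z \<le> x) ys) \<le> length (filter (\<lambda>z. z \<le> x) xs)"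
    and "\<And>x. length (filter (\<lambda>z. z \<le> x) xs) \<le> Suc (length (filter (\<lambda>z. z \<le> x) ys))"
  shows "xs ! j \<le> ys ! j \<and> ys ! j \<le> xs ! Suc j"
proof -
  note le = sorted_nth_le_iff[OF assms(1)] sorted_nth_le_iff[OF assms(2)]
  have "j < length (filter (\<lambda>z. z \<le> ys ! j) ys)"
    using le(2)[of j "ys ! j"] assms(4) by simp
  then have "xs ! j \<le> ys ! j"
    using le(1)[of j "ys ! j"] assms(3,4) assms(5)[of "ys ! j"] by simp
  moreover have "Suc j < length (filter (\<lambda>z. z \<le> xs ! Suc j) xs)"
    using le(1)[of "Suc j" "xs ! Suc j"] assms(3,4) by simp
  then have "ys ! j \<le> xs ! Suc j"
    using le(2)[of j "xs ! Suc j"] assms(3,4) assms(6)[of "xs ! Suc j"] by simp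
  ultimately show ?thesis ..
qed

text \<open>Since 0 lies in every span, \<open>sep\<close> says two things at once: \<open>J\<close>
  is injective on the span of \<open>C1\<close>, and the image of that span meets the span of
  \<open>C2\<close> only in 0. Hence the images of \<open>C1\<close> together with \<open>C2\<close>
  form an independent family.\<close>

lemma independent_combine:
  assumes C1: "fun_space.independent C1" and C2: "fun_space.independent C2"
    and fin: "finite C1" "finite C2"
    and J_add: "\<And>f g. J (f + g) = J f + J g" and J_scale: "\<And>c f. J (fun_scale c f) = fun_scale c (J f)"
    and sep: "\<And>f. f \<in> fun_space.span C1 \<Longrightarrow> J f \<in> fun_space.span C2 \<Longrightarrow> f = 0"
    and W: "finite W" "J ` C1 \<union> C2 \<subseteq> fun_space.span W"
  shows "card C1 + card C2 \<le> card W"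
proof -
  have J0: "J 0 = 0"
    using J_scale[of 0 0] by simp
  have J_sum: "J (\<Sum>x\<in>A. g x) = (\<Sum>x\<in>A. J (g x))" for g :: "'c \<Rightarrow> _" and A
    by (induction A rule: infinite_finite_induct) (simp_all add: J_add J0 del: plus_fun_apply zero_fun_apply)
  have zero: "u b = 0" if "(\<Sum>c\<in>C1. fun_scale (u c) (J c)) \<in> fun_space.span C2" "b \<in> C1" for u b
  proof -
    let ?f = "\<Sum>c\<in>C1. fun_scale (u c) c"
    have "?f \<in> fun_space.span C1"
      by (intro fun_space.span_sum fun_space.span_scale fun_space.span_base)
    moreover have "J ?f \<in> fun_space.span C2"
      using that(1) by (simp add: J_sum J_scale)
    ultimately have "?f = 0"
      by (rule sep)
    then show ?thesis
      using fun_space.independentD[OF C1 fin(1) subset_refl] that(2) by blast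
  qed
  have inj: "inj_on J C1"
  proof (rule inj_onI, rule ccontr)
    fix b c assume bc: "b \<in> C1" "c \<in> C1" "J b = J c" "b \<noteq> c"
    \<comment> \<open>The coefficients of \<open>b - c\<close>, a nontrivial combination whose image
      under \<open>J\<close> is 0.\<close>
    let ?u = "\<lambda>d. if d = b then 1 else if d = c then - 1 else (0::real)"
    have "(\<Sum>d\<in>C1. fun_scale (?u d) (J d)) = (\<Sum>d\<in>{b, c}. fun_scale (?u d) (J d))"
      using fin(1) bc by (intro sum.mono_neutral_right) auto
    also have "\<dots> = 0"
      using bc(3,4) by (auto simp: fun_scale_def fun_eq_iff)
    finally have "?u b = 0"
      using zero[of ?u b] bc(1) fun_space.span_zero by metis
    then show False by simp
  qed
  have disj: "J ` C1 \<inter> C2 = {}"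
  proof (rule ccontr)
    assume "J ` C1 \<inter> C2 \<noteq> {}"
    then obtain b where b: "b \<in> C1" "J b \<in> C2" by blast
    have "b = 0"
      by (rule sep[OF fun_space.span_base[OF b(1)] fun_space.span_base[OF b(2)]])
    then show False
      using b(1) fun_space.dependent_zero[of C1] C1 by simp
  qed
  have "fun_space.independent (J ` C1 \<union> C2)"
  proof (rule fun_space.independent_if_scalars_zero)
    show "finite (J ` C1 \<union> C2)" using fin by simp
    fix u b
    assume eq: "(\<Sum>c\<in>J ` C1 \<union> C2. fun_scale (u c) c) = 0" and b: "b \<in> J ` C1 \<union> C2"
    have eq': "(\<Sum>c\<in>C1. fun_scale (u (J c)) (J c)) + (\<Sum>c\<in>C2. fun_scale (u c) c) = 0"
      using eq fin disj by (simp add: sum.union_disjoint sum.reindex[OF inj])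
    then have "(\<Sum>c\<in>C1. fun_scale (u (J c)) (J c)) = - (\<Sum>c\<in>C2. fun_scale (u c) c)"
      by (simp add: eq_neg_iff_add_eq_0)
    also have "\<dots> \<in> fun_space.span C2"
      by (intro fun_space.span_neg fun_space.span_sum fun_space.span_scale fun_space.span_base)
    finally have z: "u (J c) = 0" if "c \<in> C1" for c
      using zero[of "\<lambda>c. u (J c)" c] that by simp
    then have "(\<Sum>c\<in>C2. fun_scale (u c) c) = 0"
      using eq' by simp
    from fun_space.independentD[OF C2 fin(2) subset_refl this] show "u b = 0"
      using z b by blast
  qed
  then have "card (J ` C1 \<union> C2) \<le> card W"
    using fun_space.independent_span_bound[OF W(1)] W(2) by blast
  then show ?thesis
    using fin disj inj by (simp add: card_Un_disjoint card_image)
qed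

text \<open>Cauchy interlacing: \<open>J_norm\<close> and \<open>J_form\<close> say that
  \<open>T\<close> is the compression of \<open>T'\<close> to a copy of \<open>V\<close> inside
  \<open>V'\<close>. The bases \<open>S\<close> and \<open>S'\<close> record the two
  dimensions.\<close>

theorem eigenvalue_interlacing:
  fixes J :: "('b \<Rightarrow> real) \<Rightarrow> ('c \<Rightarrow> real)"
  assumes "symmetric_operator V ip T" and "symmetric_operator V' ip' T'"
    and J_add: "\<And>f g. J (f + g) = J f + J g" and J_scale: "\<And>c f. J (fun_scale c f) = fun_scale c (J f)"
    and J_in: "\<And>f. f \<in> V \<Longrightarrow> J f \<in> V'"
    and J_norm: "\<And>f. f \<in> V \<Longrightarrow> ip' (J f) (J f) = ip f f"
    and J_form: "\<And>f. f \<in> V \<Longrightarrow> ip' (J f) (T' (J f)) = ip f (T f)"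
    and S: "fun_space.independent S" "fun_space.span S = V"
    and S': "fun_space.independent S'" "fun_space.span S' = V'"
    and card: "card S' = Suc (card S)"
  shows "length (eigenvalue_list V' T') = card S'" and "length (eigenvalue_list V T) = card S"
    and "j < card S \<Longrightarrow> eigenvalue_list V' T' ! j \<le> eigenvalue_list V T ! j \<and>
       eigenvalue_list V T ! j \<le> eigenvalue_list V' T' ! Suc j"
proof -
  interpret P: symmetric_operator V ip T by fact
  interpret Q: symmetric_operator V' ip' T' by fact
  obtain B where B: "P.orthogonal_eigenvectors B" "fun_space.span B = V"
    using P.eigenbasis_exists .
  obtain B' where B': "Q.orthogonal_eigenvectors B'" "fun_space.span B' = V'"
    using Q.eigenbasis_exists .
  have cB: "card B = card S" and cB': "card B' = card S'"
    using P.card_eigenbasis[OF B S] Q.card_eigenbasis[OF B' S'] by auto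
  show len': "length (eigenvalue_list V' T') = card S'"
    using Q.length_eigenvalue_list[OF B'] cB' by simp
  show len: "length (eigenvalue_list V T) = card S"
    using P.length_eigenvalue_list[OF B] cB by simp
  \<comment> \<open>A contradiction may use both \<open>f \<noteq> 0\<close> and
    \<open>J f \<noteq> 0\<close>, which are equivalent because \<open>J\<close> preserves norms.
    The strict estimate takes place in \<open>V'\<close> in one application and in \<open>V\<close>
    in the other.\<close>
  have combine: "card C + card C' \<le> Suc (card B)"
    if "C \<subseteq> B" "C' \<subseteq> B'"
      and "\<And>f. f \<in> fun_space.span C \<Longrightarrow> J f \<in> fun_space.span C' \<Longrightarrow> f \<noteq> 0 \<Longrightarrow> J f \<noteq> 0 \<Longrightarrow> False"
    for C C'
  proof -
    have "card C + card C' \<le> card B'"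
    proof (rule independent_combine[where J = J])
      show "fun_space.independent C" "fun_space.independent C'"
        using that(1,2) P.orth_independent[OF B(1)] Q.orth_independent[OF B'(1)]
          fun_space.independent_mono by blast+
      show "finite C" "finite C'" "finite B'"
        using that(1,2) P.finite_B[OF B(1)] Q.finite_B[OF B'(1)] finite_subset by blast+
      show "J ` C \<union> C' \<subseteq> fun_space.span B'"
        using that(1,2) P.B_subset[OF B(1)] Q.B_subset[OF B'(1)] J_in B'(2) by blast
      fix f assume f: "f \<in> fun_space.span C" "J f \<in> fun_space.span C'"
      then have "f \<in> V"
        using P.span_subset_V[OF B(1) that(1)] by blast
      show "f = 0"
        using that(3)[OF f] J_norm[OF \<open>f \<in> V\<close>] P.ip_self_eq_0D[OF \<open>f \<in> V\<close>] by fastforce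
    qed (fact J_add J_scale)+
    then show ?thesis
      by (simp add: cB cB' card)
  qed
  have split: "card {b \<in> A. P b} + card {b \<in> A. \<not> P b} = card A" if "finite A" for A :: "'d set" and P
  proof -
    have "{b \<in> A. P b} \<union> {b \<in> A. \<not> P b} = A" "{b \<in> A. P b} \<inter> {b \<in> A. \<not> P b} = {}"
      by blast+
    then show ?thesis
      using card_Un_disjoint[of "{b \<in> A. P b}" "{b \<in> A. \<not> P b}"] that by simp
  qed
  \<comment> \<open>In \<open>le1\<close> the complement is taken in \<open>B'\<close>, whose size
    is \<open>Suc (card B)\<close>, so the excess in \<open>combine\<close> cancels. In
    \<open>le2\<close> it is taken in \<open>B\<close>, and the excess 1 remains.\<close>
  have le1: "card {b \<in> B. P.rayleigh b \<le> x} \<le> card {b \<in> B'. Q.rayleigh b \<le> x}" for x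
  proof -
    have "card {b \<in> B. P.rayleigh b \<le> x} + card {b \<in> B'. \<not> Q.rayleigh b \<le> x} \<le> Suc (card B)"
    proof (rule combine)
      fix f assume f: "f \<in> fun_space.span {b \<in> B. P.rayleigh b \<le> x}"
        "J f \<in> fun_space.span {b \<in> B'. \<not> Q.rayleigh b \<le> x}" "J f \<noteq> 0"
      have "f \<in> V"
        using f(1) P.span_subset_V[OF B(1) Collect_subset] by (rule set_rev_mp)
      have "ip f (T f) \<le> x * ip f f"
        by (rule P.rayleigh_le_on_span[OF B(1) _ f(1)]) auto
      moreover have "x * ip' (J f) (J f) < ip' (J f) (T' (J f))"
        by (rule Q.rayleigh_gt_on_span[OF B'(1) _ f(2)]) (use f(3) in auto)
      ultimately show False
        using J_norm[OF \<open>f \<in> V\<close>] J_form[OF \<open>f \<in> V\<close>] by simp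
    qed auto
    then show ?thesis
      using split[OF Q.finite_B[OF B'(1)], of "\<lambda>b. Q.rayleigh b \<le> x"] cB cB' card by simp
  qed
  have le2: "card {b \<in> B'. Q.rayleigh b \<le> x} \<le> Suc (card {b \<in> B. P.rayleigh b \<le> x})" for x
  proof -
    have "card {b \<in> B. \<not> P.rayleigh b \<le> x} + card {b \<in> B'. Q.rayleigh b \<le> x} \<le> Suc (card B)"
    proof (rule combine)
      fix f assume f: "f \<in> fun_space.span {b \<in> B. \<not> P.rayleigh b \<le> x}"
        "J f \<in> fun_space.span {b \<in> B'. Q.rayleigh b \<le> x}" "f \<noteq> 0"
      have "f \<in> V"
        using f(1) P.span_subset_V[OF B(1) Collect_subset] by (rule set_rev_mp)
      have "x * ip f f < ip f (T f)"
        by (rule P.rayleigh_gt_on_span[OF B(1) _ f(1)]) (use f(3) in auto)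
      moreover have "ip' (J f) (T' (J f)) \<le> x * ip' (J f) (J f)"
        by (rule Q.rayleigh_le_on_span[OF B'(1) _ f(2)]) auto
      ultimately show False
        using J_norm[OF \<open>f \<in> V\<close>] J_form[OF \<open>f \<in> V\<close>] by simp
    qed auto
    then show ?thesis
      using split[OF P.finite_B[OF B(1)], of "\<lambda>b. P.rayleigh b \<le> x"] by simp
  qed
  show "eigenvalue_list V' T' ! j \<le> eigenvalue_list V T ! j \<and>
       eigenvalue_list V T ! j \<le> eigenvalue_list V' T' ! Suc j" if "j < card S"
    using that le1 le2
    by (intro interlacing_if_counts)
      (simp_all add: sorted_eigenvalue_list len len' card P.length_filter_eigenvalue_list[OF B]
        Q.length_filter_eigenvalue_list[OF B'])
qed

section \<open>Cochains\<close>

text \<open>Adjacent swaps carry the head of one list to its place in the other; the induction then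
  runs for the function that prepends this element before applying \<open>h\<close>.\<close>

lemma invariant_under_adjacent_swaps:
  assumes "\<And>u x y v. h (u @ x # y # v) = h (u @ y # x # v)" "mset xs = mset ys"
  shows "h xs = h ys"
  using assms
proof (induction xs arbitrary: ys h)
  case (Cons x xs)
  have move: "h (p @ x # u @ v) = h (p @ u @ x # v)" for p u v
  proof (induction u arbitrary: p)
    case (Cons a u)
    show ?case
      using Cons.IH[of "p @ [a]"] \<open>\<And>u x y v. h (u @ x # y # v) = h (u @ y # x # v)\<close>[of p x a "u @ v"]
      by simp
  qed simp
  have "x \<in> set ys"
    using Cons.prems(2) by (metis list.set_intros(1) mset_eq_setD)
  then obtain u v where ys: "ys = u @ x # v"
    by (meson split_list)
  have "h (x # xs) = h (x # u @ v)"
  proof (rule Cons.IH[of "\<lambda>l. h (x # l)"])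
    show "h (x # u @ y # z # v) = h (x # u @ z # y # v)" for u y z v
      using Cons.prems(1)[of "x # u"] by simp
    show "mset xs = mset (u @ v)"
      using Cons.prems(2) ys by simp
  qed
  then show ?case
    using move[of "[]"] ys by simp
qed simp

text \<open>In a distinct list an entry determines its position. This makes the permutation
  described in \<open>unit_cochain\<close> unique.\<close>

lemma permute_list_inj:
  assumes p: "p permutes {..<length xs}" and q: "q permutes {..<length xs}" and "distinct xs"
    and eq: "permute_list p xs = permute_list q xs"
  shows "p = q"
proof
  fix k
  show "p k = q k"
  proof (cases "k < length xs")
    case True
    then have "xs ! p k = xs ! q k"
      using permute_list_nth[OF p True] permute_list_nth[OF q True] eq by simp
    then show ?thesis
      using True permutes_in_image[OF p, of k] permutes_in_image[OF q, of k] \<open>distinct xs\<close>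
      by (simp add: nth_eq_iff_index_eq)
  next
    case False
    then show ?thesis
      using permutes_not_in[OF p] permutes_not_in[OF q] by simp
  qed
qed

lemma permute_list_adjacent:
  "permute_list (transpose (length u) (Suc (length u))) (u @ x # y # v) = u @ y # x # v"
proof (rule nth_equalityI)
  let ?t = "transpose (length u) (Suc (length u))"
  fix k assume "k < length (permute_list ?t (u @ x # y # v))"
  moreover have "?t permutes {..<length (u @ x # y # v)}"
    by (rule permutes_swap_id) auto
  ultimately have "permute_list ?t (u @ x # y # v) ! k = (u @ x # y # v) ! ?t k"
    by (simp add: permute_list_nth)
  also have "\<dots> = (u @ y # x # v) ! k"
    by (auto simp: transpose_def nth_append nth_Cons split: nat.split)
  finally show "permute_list ?t (u @ x # y # v) ! k = (u @ y # x # v) ! k" .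
qed simp

section \<open>Orderings of faces and alternating functions\<close>

lemma distinct_orient: "finite F \<Longrightarrow> distinct (orient F)"
  and set_orient: "finite F \<Longrightarrow> set (orient F) = F"
  using someI_ex[of "\<lambda>l. distinct l \<and> set l = F"] finite_distinct_list[of F]
  by (auto simp: orient_def)

lemma length_orient: "finite F \<Longrightarrow> length (orient F) = card F"
  by (metis distinct_card distinct_orient set_orient)

lemma finite_faces: "finite K \<Longrightarrow> finite (faces i K)"
  by (simp add: faces_def)

lemma finite_face: "F \<in> faces i K \<Longrightarrow> finite F"
  by (simp add: faces_def)

lemma orient_ordered_faces: "F \<in> faces i K \<Longrightarrow> orient F \<in> ordered_faces i K"
  by (simp add: ordered_faces_def distinct_orient set_orient finite_face)

lemma length_ordered_faces: "l \<in> ordered_faces i K \<Longrightarrow> length l = Suc i"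
  by (auto simp: ordered_faces_def faces_def distinct_card)

lemma ordered_faces_permutation:
  assumes "l \<in> ordered_faces i K" "distinct l'" "set l' = set l"
  obtains p where "p permutes {..<length l}" "permute_list p l = l'"
proof -
  have "mset l' = mset l"
    using assms by (simp add: ordered_faces_def set_eq_iff_mset_eq_distinct)
  then show thesis
    using mset_eq_permutation that by metis
qed

lemma cochains_outside: "f \<in> cochains i K \<Longrightarrow> l \<notin> ordered_faces i K \<Longrightarrow> f l = 0"
  by (simp add: cochains_def)

lemma cochains_permute:
  "f \<in> cochains i K \<Longrightarrow> l \<in> ordered_faces i K \<Longrightarrow> p permutes {..<length l} \<Longrightarrow>
    f (permute_list p l) = of_int (sign p) * f l"
  by (simp add: cochains_def)

lemma subspace_cochains: "fun_space.subspace (cochains i K)"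
  by (auto simp: fun_space.subspace_def cochains_def fun_scale_def algebra_simps)

text \<open>The sign of the reordering enters both factors and squares to 1. This allows inner
  products to be evaluated at the image of an oriented face instead of the orientation chosen by
  \<open>orient\<close>.\<close>

lemma cochains_prod_orientation:
  assumes "f \<in> cochains i K" "g \<in> cochains i K" "l \<in> ordered_faces i K" "distinct l'" "set l' = set l"
  shows "f l' * g l' = f l * g l"
proof -
  obtain p where "p permutes {..<length l}" "permute_list p l = l'"
    using ordered_faces_permutation assms(3-5) .
  then have "f l' * g l' = of_int (sign p * sign p) * (f l * g l)"
    using cochains_permute[OF assms(1,3), of p] cochains_permute[OF assms(2,3), of p]
    by (simp del: sign_idempotent)
  then show ?thesis by simp
qed

lemma cochains_eqI:
  assumes "f \<in> cochains i K" "g \<in> cochains i K"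
    and "\<And>F. F \<in> faces i K \<Longrightarrow> f (orient F) = g (orient F)"
  shows "f = g"
proof
  fix l
  show "f l = g l"
  proof (cases "l \<in> ordered_faces i K")
    case True
    then have F: "set l \<in> faces i K" "distinct l"
      by (auto simp: ordered_faces_def)
    obtain p where "p permutes {..<length (orient (set l))}" "permute_list p (orient (set l)) = l"
      using ordered_faces_permutation[OF orient_ordered_faces[OF F(1)] F(2)]
        set_orient[OF finite_face[OF F(1)]] by metis
    then show ?thesis
      using cochains_permute[OF assms(1) orient_ordered_faces[OF F(1)]]
        cochains_permute[OF assms(2) orient_ordered_faces[OF F(1)]] assms(3)[OF F(1)] by metis
  qed (use assms(1,2) in \<open>simp add: cochains_outside\<close>)
qed

lemma cochains_swap_adjacent:
  assumes "f \<in> cochains i K"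
  shows "f (u @ y # x # v) = - f (u @ x # y # v)"
proof (cases "u @ x # y # v \<in> ordered_faces i K")
  case True
  have "transpose (length u) (Suc (length u)) permutes {..<length (u @ x # y # v)}"
    by (rule permutes_swap_id) auto
  from cochains_permute[OF assms True this] show ?thesis
    by (simp add: permute_list_adjacent sign_swap_id)
next
  case False
  then have "u @ y # x # v \<notin> ordered_faces i K"
    by (auto simp: ordered_faces_def insert_commute)
  then show ?thesis
    using False assms by (simp add: cochains_outside)
qed

text \<open>The dual basis vector of the oriented face \<open>orient F\<close>; on any other
  ordering of \<open>F\<close> its value is the sign of the permutation leading there.\<close>

definition unit_cochain :: "'a set \<Rightarrow> 'a list \<Rightarrow> real" where
  "unit_cochain F l =
     (if distinct l \<and> set l = F
      then of_int (sign (THE p. p permutes {..<card F} \<and> permute_list p (orient F) = l)) else 0)"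

lemma unit_cochain_permute:
  assumes "finite F" "p permutes {..<card F}"
  shows "unit_cochain F (permute_list p (orient F)) = of_int (sign p)"
proof -
  have "(THE q. q permutes {..<card F} \<and> permute_list q (orient F) = permute_list p (orient F)) = p"
    using assms permute_list_inj[of _ "orient F" p]
    by (intro the_equality) (auto simp: length_orient distinct_orient)
  then show ?thesis
    using assms by (simp add: unit_cochain_def length_orient distinct_orient set_orient)
qed

lemma unit_cochain_orient:
  assumes "finite F" "finite G"
  shows "unit_cochain F (orient G) = (if G = F then 1 else 0)"
  using unit_cochain_permute[OF assms(1) permutes_id] assms
  by (auto simp: unit_cochain_def set_orient)

text \<open>If \<open>q\<close> carries \<open>orient F\<close> to \<open>l\<close>, then
  \<open>q \<circ> p\<close> carries it to the permuted list, and signs multiply.\<close>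

lemma unit_cochain_in_cochains:
  assumes F: "F \<in> faces i K"
  shows "unit_cochain F \<in> cochains i K"
  unfolding cochains_def
proof (intro CollectI conjI allI impI ballI)
  fix l assume "l \<notin> ordered_faces i K"
  then show "unit_cochain F l = 0"
    using F by (auto simp: unit_cochain_def ordered_faces_def)
next
  fix l p assume l: "l \<in> ordered_faces i K" and p: "p permutes {..<length l}"
  show "unit_cochain F (permute_list p l) = of_int (sign p) * unit_cochain F l"
  proof (cases "set l = F")
    case True
    have len: "length (orient F) = length l" "card F = length l"
      using l True finite_face[OF F] by (auto simp: ordered_faces_def length_orient distinct_card)
    obtain q where q: "q permutes {..<length (orient F)}" "permute_list q (orient F) = l"
      using ordered_faces_permutation[OF orient_ordered_faces[OF F], of l] l True
        set_orient[OF finite_face[OF F]] by (metis (no_types, lifting) mem_Collect_eq ordered_faces_def)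
    have qp: "q \<circ> p permutes {..<card F}"
      using permutes_compose[of p _ q] p q(1) len by simp
    have "permute_list p l = permute_list (q \<circ> p) (orient F)"
      using permute_list_compose[of p "orient F" q] p q len by simp
    moreover have "sign (q \<circ> p) = sign q * sign p"
      using p q(1) by (intro sign_compose) (auto simp: permutation_permutes)
    ultimately have "unit_cochain F (permute_list p l) = of_int (sign p) * of_int (sign q)"
      using unit_cochain_permute[OF finite_face[OF F] qp] by simp
    moreover have "unit_cochain F l = of_int (sign q)"
      using unit_cochain_permute[OF finite_face[OF F], of q] q len by simp
    ultimately show ?thesis by simp
  next
    case False
    then show ?thesis
      using p by (simp add: unit_cochain_def)
  qed
qed

lemma sum_fun_apply: "(\<Sum>x\<in>A. h x) y = (\<Sum>x\<in>A. h x y)"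
  by (induction A rule: infinite_finite_induct) simp_all

lemma cochains_expand:
  assumes "finite K" "f \<in> cochains i K"
  shows "f = (\<Sum>F\<in>faces i K. fun_scale (f (orient F)) (unit_cochain F))"
proof (rule cochains_eqI[OF assms(2)])
  show "(\<Sum>F\<in>faces i K. fun_scale (f (orient F)) (unit_cochain F)) \<in> cochains i K"
    by (intro fun_space.subspace_sum fun_space.subspace_scale subspace_cochains unit_cochain_in_cochains)
  fix G assume G: "G \<in> faces i K"
  have "(\<Sum>F\<in>faces i K. fun_scale (f (orient F)) (unit_cochain F)) (orient G)
      = (\<Sum>F\<in>faces i K. f (orient F) * unit_cochain F (orient G))"
    by (simp add: sum_fun_apply fun_scale_def)
  also have "\<dots> = (\<Sum>F\<in>faces i K. if F = G then f (orient G) else 0)"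
    using G by (intro sum.cong) (auto simp: unit_cochain_orient finite_face)
  finally show "f (orient G) = (\<Sum>F\<in>faces i K. fun_scale (f (orient F)) (unit_cochain F)) (orient G)"
    using G assms(1) by (simp add: finite_faces)
qed

lemma inj_on_unit_cochain: "inj_on unit_cochain (faces i K)"
  by (rule inj_onI) (metis finite_face unit_cochain_orient zero_neq_one)

lemma span_unit_cochains:
  assumes "finite K"
  shows "fun_space.span (unit_cochain ` faces i K) = cochains i K"
proof
  show "fun_space.span (unit_cochain ` faces i K) \<subseteq> cochains i K"
    using unit_cochain_in_cochains by (intro fun_space.span_minimal subspace_cochains) auto
  show "cochains i K \<subseteq> fun_space.span (unit_cochain ` faces i K)"
  proof
    fix f assume "f \<in> cochains i K"
    then show "f \<in> fun_space.span (unit_cochain ` faces i K)"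
      by (subst cochains_expand[OF assms, of f i])
        (auto intro!: fun_space.span_sum fun_space.span_scale intro: fun_space.span_base)
  qed
qed

section \<open>The inner product and the basis of unit cochains\<close>

lemma cochain_inner_add: "cochain_inner i K w (f + g) h = cochain_inner i K w f h + cochain_inner i K w g h"
  by (simp add: cochain_inner_def sum.distrib algebra_simps)

lemma cochain_inner_scale: "cochain_inner i K w (fun_scale c f) h = c * cochain_inner i K w f h"
  by (simp add: cochain_inner_def fun_scale_def sum_distrib_left algebra_simps)

lemma cochain_inner_sym: "cochain_inner i K w f h = cochain_inner i K w h f"
  by (simp add: cochain_inner_def algebra_simps)

lemma cochain_inner_sum:
  "cochain_inner i K w (\<Sum>x\<in>A. f x) h = (\<Sum>x\<in>A. cochain_inner i K w (f x) h)"
proof (induction A rule: infinite_finite_induct)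
  case (insert x F)
  then show ?case by (simp add: cochain_inner_add del: plus_fun_apply)
qed (simp_all add: cochain_inner_def)

lemma cochain_inner_unit:
  assumes "finite K" "F \<in> faces i K"
  shows "cochain_inner i K w (unit_cochain F) h = w F * h (orient F)"
proof -
  have "cochain_inner i K w (unit_cochain F) h = (\<Sum>G\<in>faces i K. if G = F then w F * h (orient F) else 0)"
    unfolding cochain_inner_def using assms
    by (intro sum.cong) (auto simp: unit_cochain_orient finite_face)
  then show ?thesis
    using assms by (simp add: finite_faces)
qed

lemma independent_unit_cochains:
  assumes fin: "finite K"
  shows "fun_space.independent (unit_cochain ` faces i K)"
proof (rule fun_space.independent_if_scalars_zero)
  show "finite (unit_cochain ` faces i K)"
    by (simp add: fin finite_faces)
  fix u f assume sum: "(\<Sum>c\<in>unit_cochain ` faces i K. fun_scale (u c) c) = 0" and "f \<in> unit_cochain ` faces i K"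
  then obtain F where F: "F \<in> faces i K" "f = unit_cochain F" by blast
  \<comment> \<open>Independence does not involve a weight, so the pairing with weight 1 is used to
    extract the coefficient of \<open>f\<close>.\<close>
  have "0 = cochain_inner i K (\<lambda>_. 1) (\<Sum>G\<in>faces i K. fun_scale (u (unit_cochain G)) (unit_cochain G)) f"
    using sum by (simp add: sum.reindex[OF inj_on_unit_cochain] cochain_inner_def)
  also have "\<dots> = (\<Sum>G\<in>faces i K. u (unit_cochain G) * unit_cochain F (orient G))"
    unfolding cochain_inner_sum cochain_inner_scale F(2)
    by (intro sum.cong refl) (simp add: cochain_inner_unit[OF fin])
  also have "\<dots> = (\<Sum>G\<in>faces i K. if G = F then u f else 0)"
    using F by (intro sum.cong) (auto simp: unit_cochain_orient finite_face)
  finally show "u f = 0"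
    using F fin by (simp add: finite_faces)
qed

lemma cochain_inner_pos:
  assumes "finite K" "\<And>F. F \<in> faces i K \<Longrightarrow> 0 < w F" "f \<in> cochains i K" "f \<noteq> 0"
  shows "0 < cochain_inner i K w f f"
proof -
  obtain F where F: "F \<in> faces i K" "f (orient F) \<noteq> 0"
    using cochains_eqI[OF assms(3) fun_space.subspace_0[OF subspace_cochains]] assms(4) by auto
  show ?thesis
    unfolding cochain_inner_def
  proof (rule sum_pos2[OF finite_faces[OF assms(1)] F(1)])
    show "0 < w F * f (orient F) * f (orient F)"
      using F assms(2) by (simp add: mult.assoc zero_less_mult_iff) (auto simp: linorder_neq_iff)
    show "0 \<le> w G * f (orient G) * f (orient G)" if "G \<in> faces i K" for G
      using assms(2)[OF that] by (simp add: mult.assoc)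
  qed
qed

section \<open>The coboundary under change of orientation\<close>

lemma coboundary_add: "coboundary i K (f + g) = coboundary i K f + coboundary i K g"
  by (rule ext) (simp add: coboundary_def sum.distrib algebra_simps)

lemma coboundary_scale: "coboundary i K (fun_scale c f) = fun_scale c (coboundary i K f)"
  by (rule ext) (simp add: coboundary_def fun_scale_def sum_distrib_left algebra_simps)

lemma coboundary_sum: "coboundary i K (\<Sum>x\<in>A. f x) = (\<Sum>x\<in>A. coboundary i K (f x))"
proof (induction A rule: infinite_finite_induct)
  case (insert x F)
  then show ?case by (simp add: coboundary_add del: plus_fun_apply)
qed (simp_all add: coboundary_def fun_eq_iff)

text \<open>Deleting position j of one list is compared with deleting position \<open>?t j\<close>
  of the other. For j outside the swapped pair the remaining lists differ by an adjacent swap, which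
  changes the sign of \<open>f\<close>; for the pair itself they coincide, but the power of -1
  changes sign.\<close>

lemma coboundary_swap_adjacent:
  assumes f: "f \<in> cochains i K"
  shows "coboundary i K f (u @ y # x # v) = - coboundary i K f (u @ x # y # v)"
proof (cases "u @ x # y # v \<in> ordered_faces (Suc i) K")
  case True
  define a where "a = length u"
  define d where "d = (\<lambda>j l. take j l @ drop (Suc j) l :: 'a list)"
  let ?l = "u @ x # y # v" and ?l' = "u @ y # x # v" and ?t = "transpose a (Suc a)"
  have True': "?l' \<in> ordered_faces (Suc i) K"
    using True by (auto simp: ordered_faces_def insert_commute)
  have "length ?l = Suc (Suc i)"
    using length_ordered_faces[OF True] .
  then have "a \<le> i" by (simp add: a_def)
  have perm: "?t permutes {..Suc i}"
    using \<open>a \<le> i\<close> by (intro permutes_swap_id) auto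
  have "(- 1) ^ ?t j * f (d (?t j) ?l') = - ((- 1) ^ j * f (d j ?l))" for j
  proof -
    consider "j < a" | "j = a" | "j = Suc a" | k where "j = a + 2 + k"
      by (metis add_2_eq_Suc' le_Suc_ex le_antisym not_less not_less_eq_eq)
    then show ?thesis
    proof cases
      case 1
      then have "d j ?l = d j u @ x # y # v" "d j ?l' = d j u @ y # x # v"
        by (auto simp: d_def a_def)
      then show ?thesis
        using 1 cochains_swap_adjacent[OF f, of "d j u" y x v] by (simp add: transpose_def)
    next
      case 2
      then have "d (Suc j) ?l' = d j ?l"
        by (simp add: d_def a_def)
      then show ?thesis
        using 2 by simp
    next
      case 3
      then have "d a ?l' = d j ?l"
        by (simp add: d_def a_def)
      then show ?thesis
        using 3 by simp
    next
      case (4 k)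
      then have "d j ?l = u @ x # y # d k v" "d j ?l' = u @ y # x # d k v"
        by (auto simp: d_def a_def numeral_3_eq_3)
      then show ?thesis
        using 4 cochains_swap_adjacent[OF f, of u y x "d k v"] by (simp add: transpose_def)
    qed
  qed
  then have "(\<Sum>j\<le>Suc i. (- 1) ^ j * f (d j ?l')) = (\<Sum>j\<le>Suc i. - ((- 1) ^ j * f (d j ?l)))"
    using sum.permute[OF perm, of "\<lambda>j. (- 1) ^ j * f (d j ?l')"] by (simp add: o_def del: sum.atMost_Suc)
  then show ?thesis
    using True True' by (simp add: coboundary_def d_def sum_negf del: sum.atMost_Suc)
next
  case False
  then have "u @ y # x # v \<notin> ordered_faces (Suc i) K"
    by (auto simp: ordered_faces_def insert_commute)
  then show ?thesis
    using False by (simp add: coboundary_def)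
qed

text \<open>Squaring removes the sign of an adjacent swap, and adjacent swaps connect all orderings
  of a face.\<close>

lemma coboundary_square_orientation:
  assumes "f \<in> cochains i K" "distinct l" "distinct l'" "set l = set l'"
  shows "(coboundary i K f l)\<^sup>2 = (coboundary i K f l')\<^sup>2"
proof (rule invariant_under_adjacent_swaps)
  show "mset l = mset l'"
    using assms by (simp add: set_eq_iff_mset_eq_distinct)
  show "(coboundary i K f (u @ x # y # v))\<^sup>2 = (coboundary i K f (u @ y # x # v))\<^sup>2" for u x y v
    using coboundary_swap_adjacent[OF assms(1), of u y x v] by simp
qed

section \<open>The adjoint and the up-Laplacian\<close>

context
  fixes K :: "'a set set" and w :: "'a set \<Rightarrow> real" and i :: nat
  assumes fin: "finite K" and w_pos: "\<And>F. F \<in> faces i K \<Longrightarrow> 0 < w F"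
begin

text \<open>Testing against \<open>unit_cochain F\<close> forces
  \<open>w F * h (orient F) = L (unit_cochain F)\<close>. Positivity of the weight allows division,
  and the cochain with these values works by linearity.\<close>

lemma coboundary_adjoint_unique_exists:
  "\<exists>!h. h \<in> cochains i K \<and>
     (\<forall>f\<in>cochains i K. cochain_inner (Suc i) K w (coboundary i K f) g = cochain_inner i K w f h)"
proof (rule ex_ex1I)
  define L where "L = (\<lambda>f. cochain_inner (Suc i) K w (coboundary i K f) g)"
  define h where "h = (\<Sum>F\<in>faces i K. fun_scale (L (unit_cochain F) / w F) (unit_cochain F))"
  have h: "h \<in> cochains i K"
    unfolding h_def
    by (intro fun_space.subspace_sum fun_space.subspace_scale subspace_cochains unit_cochain_in_cochains)
  have hF: "w F * h (orient F) = L (unit_cochain F)" if F: "F \<in> faces i K" for F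
  proof -
    have "w F * h (orient F) = cochain_inner i K w h (unit_cochain F)"
      using cochain_inner_unit[OF fin F] by (simp add: cochain_inner_sym)
    also have "\<dots> = (\<Sum>G\<in>faces i K. L (unit_cochain G) / w G * (w G * unit_cochain F (orient G)))"
      unfolding h_def cochain_inner_sum cochain_inner_scale
      by (intro sum.cong refl) (simp add: cochain_inner_unit[OF fin])
    also have "\<dots> = (\<Sum>G\<in>faces i K. if G = F then L (unit_cochain F) else 0)"
      using w_pos F by (intro sum.cong) (auto simp: unit_cochain_orient finite_face less_imp_neq[symmetric])
    finally show ?thesis
      using F fin by (simp add: finite_faces)
  qed
  have "L f = cochain_inner i K w f h" if "f \<in> cochains i K" for f
  proof -
    have "L f = L (\<Sum>F\<in>faces i K. fun_scale (f (orient F)) (unit_cochain F))"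
      using cochains_expand[OF fin that] by simp
    also have "\<dots> = (\<Sum>F\<in>faces i K. f (orient F) * L (unit_cochain F))"
      by (simp only: L_def coboundary_sum coboundary_scale cochain_inner_sum cochain_inner_scale)
    also have "\<dots> = cochain_inner i K w f h"
      unfolding cochain_inner_def by (intro sum.cong refl) (simp add: hF[symmetric])
    finally show ?thesis .
  qed
  then show "\<exists>h. h \<in> cochains i K \<and>
     (\<forall>f\<in>cochains i K. cochain_inner (Suc i) K w (coboundary i K f) g = cochain_inner i K w f h)"
    using h unfolding L_def by blast
next
  fix h h'
  assume h: "h \<in> cochains i K \<and>
     (\<forall>f\<in>cochains i K. cochain_inner (Suc i) K w (coboundary i K f) g = cochain_inner i K w f h)"
    and h': "h' \<in> cochains i K \<and>
     (\<forall>f\<in>cochains i K. cochain_inner (Suc i) K w (coboundary i K f) g = cochain_inner i K w f h')"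
  show "h = h'"
  proof (rule cochains_eqI[of h i K])
    fix F assume F: "F \<in> faces i K"
    have "cochain_inner i K w (unit_cochain F) h = cochain_inner i K w (unit_cochain F) h'"
      using h h' unit_cochain_in_cochains[OF F] by metis
    then show "h (orient F) = h' (orient F)"
      using w_pos[OF F] by (simp add: cochain_inner_unit[OF fin F])
  qed (use h h' in auto)
qed

text \<open>The defining property of the adjoint. For \<open>f = g\<close> the quadratic form of the
  Laplacian becomes the squared norm of the coboundary, the form in which the two complexes are
  compared.\<close>

lemma up_laplacian_in_cochains: "up_laplacian i K w g \<in> cochains i K"
  and cochain_inner_up_laplacian:
    "f \<in> cochains i K \<Longrightarrow>
      cochain_inner i K w f (up_laplacian i K w g)
        = cochain_inner (Suc i) K w (coboundary i K f) (coboundary i K g)"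
  using theI'[OF coboundary_adjoint_unique_exists[of "coboundary i K g"]]
  unfolding up_laplacian_def coboundary_adjoint_def by auto

lemma symmetric_operator_up_laplacian:
  "symmetric_operator (cochains i K) (cochain_inner i K w) (up_laplacian i K w)"
proof
  show "\<exists>S. finite S \<and> cochains i K \<subseteq> fun_space.span S"
    using span_unit_cochains[OF fin, of i] finite_faces[OF fin] by blast
  show "cochain_inner i K w f (up_laplacian i K w g) = cochain_inner i K w (up_laplacian i K w f) g"
    if "f \<in> cochains i K" "g \<in> cochains i K" for f g
    using that cochain_inner_up_laplacian[of f g] cochain_inner_up_laplacian[of g f]
    by (simp add: cochain_inner_sym)
  show "cochain_inner i K w f g = cochain_inner i K w g f" for f g
    by (rule cochain_inner_sym)
qed (simp_all add: subspace_cochains cochain_inner_add cochain_inner_scale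
    up_laplacian_in_cochains cochain_inner_pos fin w_pos)

end

section \<open>Identifying two faces\<close>

text \<open>The index set of the sums in \<open>face_degree\<close> and
  \<open>normalized_weight\<close>.\<close>

definition cofaces :: "'a set set \<Rightarrow> 'a set \<Rightarrow> 'a set set" where
  "cofaces K F = {G \<in> K. finite G \<and> card G = Suc (card F) \<and> F \<subset> G}"

lemma finite_cofaces: "finite K \<Longrightarrow> finite (cofaces K F)"
  by (simp add: cofaces_def)

text \<open>The termination measure of \<open>normalized_weight\<close>, reused for inductions from
  the facets downwards.\<close>

lemma cofaces_measure:
  assumes "finite K" "G \<in> cofaces K F"
  shows "card {H \<in> K. G \<subset> H} < card {H \<in> K. F \<subset> H}"
  using assms by (intro psubset_card_mono) (auto simp: cofaces_def)

text \<open>By closure under subsets, a face strictly above \<open>F\<close> contains one with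
  exactly one more vertex than \<open>F\<close>.\<close>

lemma is_facet_iff_cofaces:
  assumes K: "finite_abstract_complex K" and F: "F \<in> K"
  shows "is_facet K F \<longleftrightarrow> cofaces K F = {}"
proof
  assume "is_facet K F"
  then show "cofaces K F = {}"
    by (auto simp: is_facet_def cofaces_def)
next
  assume empty: "cofaces K F = {}"
  have "\<not> F \<subset> G" if G: "G \<in> K" for G
  proof
    assume "F \<subset> G"
    then obtain v where v: "v \<in> G" "v \<notin> F" by blast
    have "finite G" "\<forall>H\<subseteq>G. H \<in> K"
      using K G by (auto simp: finite_abstract_complex_def)
    then have "insert v F \<in> cofaces K F"
      using v \<open>F \<subset> G\<close> finite_subset[of F G] by (auto simp: cofaces_def)
    with empty show False by blast
  qed
  then show "is_facet K F"
    using F by (simp add: is_facet_def)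
qed

lemma normalized_weight_cofaces:
  assumes "finite_abstract_complex K" "F \<in> K"
  shows "normalized_weight K F =
    (if cofaces K F = {} then 1 else (\<Sum>G\<in>cofaces K F. normalized_weight K G))"
  using assms is_facet_iff_cofaces[OF assms] normalized_weight_facet[of K F]
    normalized_weight_not_facet[of K F]
  by (simp add: finite_abstract_complex_def face_degree_def cofaces_def)

lemma normalized_weight_pos:
  assumes K: "finite_abstract_complex K" and "F \<in> K"
  shows "0 < normalized_weight K F"
  using \<open>F \<in> K\<close>
proof (induction F rule: measure_induct_rule[where f = "\<lambda>F. card {H \<in> K. F \<subset> H}"])
  case (less F)
  have fin: "finite K"
    using K by (simp add: finite_abstract_complex_def)
  have "0 < normalized_weight K G" if "G \<in> cofaces K F" for G
    using less.IH[OF cofaces_measure[OF fin that]] that by (simp add: cofaces_def)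
  then show ?case
    using normalized_weight_cofaces[OF K less.prems] finite_cofaces[OF fin]
    by (simp add: sum_pos)
qed

text \<open>The quotient map \<open>g\<close> identifies the i-faces \<open>A\<close> and
  \<open>B\<close>. By \<open>lift_subset\<close>, inclusions between images come from inclusions in
  \<open>D\<close>, up to exchanging \<open>A\<close> and \<open>B\<close>; the size bound excludes
  smaller faces, several of which may be merged. \<open>no_common_coface\<close> makes the cofaces
  of \<open>A\<close> and \<open>B\<close> disjoint, so that their weights add.\<close>

locale face_gluing =
  fixes D :: "'a set set" and K :: "'c set set" and g :: "'a \<Rightarrow> 'c" and A B :: "'a set" and i :: nat
  assumes complex_D: "finite_abstract_complex D"
    and K_eq: "K = image g ` D"
    and inj_face: "F \<in> D \<Longrightarrow> inj_on g F"
    and A_face: "A \<in> faces i D" and B_face: "B \<in> faces i D" and gA_eq_gB: "g ` A = g ` B"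
    and no_common_coface: "G \<in> D \<Longrightarrow> A \<subseteq> G \<Longrightarrow> \<not> B \<subseteq> G"
    and lift_subset: "F \<in> D \<Longrightarrow> G \<in> D \<Longrightarrow> Suc i \<le> card F \<Longrightarrow> g ` F \<subseteq> g ` G \<Longrightarrow>
      F \<subseteq> G \<or> F = A \<and> B \<subseteq> G \<or> F = B \<and> A \<subseteq> G"
begin

lemma finite_D: "finite D" and finite_in_D: "F \<in> D \<Longrightarrow> finite F"
  and D_closed: "F \<in> D \<Longrightarrow> G \<subseteq> F \<Longrightarrow> G \<in> D"
  using complex_D by (auto simp: finite_abstract_complex_def)

lemma complex_K: "finite_abstract_complex K"
  unfolding finite_abstract_complex_def
proof (intro conjI ballI allI impI)
  show "finite K" by (simp add: K_eq finite_D)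
  have "{} \<in> D" using complex_D by (simp add: finite_abstract_complex_def)
  then show "{} \<in> K" by (force simp: K_eq)
  fix F assume "F \<in> K"
  then obtain F' where F': "F' \<in> D" "F = g ` F'" by (auto simp: K_eq)
  then show "finite F" by (simp add: finite_in_D)
  fix G assume "G \<subseteq> F"
  then obtain G' where "G' \<subseteq> F'" "G = g ` G'"
    using F'(2) by (auto simp: subset_image_iff)
  then show "G \<in> K"
    using D_closed F'(1) by (auto simp: K_eq)
qed

lemma finite_K: "finite K"
  by (simp add: K_eq finite_D)

lemma card_image_face: "F \<in> D \<Longrightarrow> card (g ` F) = card F"
  by (simp add: card_image inj_face)

lemma glued_faces: "A \<in> D" "B \<in> D" "card A = Suc i" "card B = Suc i" "A \<noteq> B"
  using A_face B_face no_common_coface[of A] by (auto simp: faces_def)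

text \<open>Equal images have equal size, which turns the inclusions of \<open>lift_subset\<close>
  into equalities.\<close>

lemma image_eqD:
  assumes "F \<in> D" "G \<in> D" "Suc i \<le> card F" "g ` F = g ` G"
  shows "F = G \<or> F = A \<and> G = B \<or> F = B \<and> G = A"
proof -
  have card: "card F = card G"
    using card_image_face[OF assms(1)] card_image_face[OF assms(2)] assms(4) by simp
  have eq: "F' = G" if "F' \<subseteq> G" "card F' = card F" for F'
    using card_subset_eq[OF finite_in_D[OF assms(2)] that(1)] that(2) card by simp
  from lift_subset[OF assms(1-3) eq_refl[OF assms(4)]] show ?thesis
    using eq[of F] eq[of A] eq[of B] glued_faces(3,4) by (elim disjE conjE) simp_all
qed

lemma inj_on_image_large: "inj_on (image g) {F \<in> D. Suc (Suc i) \<le> card F}"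
proof (rule inj_onI)
  fix F G assume "F \<in> {F \<in> D. Suc (Suc i) \<le> card F}" "G \<in> {F \<in> D. Suc (Suc i) \<le> card F}" "g ` F = g ` G"
  then show "F = G"
    using image_eqD[of F G] glued_faces(3,4) by auto
qed

lemma image_cofaces_subset: "F \<in> D \<Longrightarrow> image g ` cofaces D F \<subseteq> cofaces K (g ` F)"
proof (rule image_subsetI)
  fix G assume F: "F \<in> D" and G: "G \<in> cofaces D F"
  then have "card (g ` F) \<noteq> card (g ` G)" "g ` F \<subseteq> g ` G"
    by (auto simp: cofaces_def card_image_face)
  then have "g ` F \<subset> g ` G"
    by (metis psubsetI)
  then show "g ` G \<in> cofaces K (g ` F)"
    using F G by (simp add: cofaces_def K_eq card_image_face)
qed

lemma cofaces_lift:
  assumes F: "F \<in> D" "Suc i \<le> card F" and H: "H \<in> cofaces K (g ` F)"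
  obtains G where "H = g ` G" "G \<in> cofaces D F \<or> F = A \<and> G \<in> cofaces D B \<or> F = B \<and> G \<in> cofaces D A"
proof -
  have H': "H \<in> K" "g ` F \<subseteq> H" "card H = Suc (card F)"
    using F H by (auto simp: cofaces_def card_image_face)
  then obtain G where G: "G \<in> D" "H = g ` G"
    by (auto simp: K_eq)
  then have GF: "g ` F \<subseteq> g ` G" "card G = Suc (card F)"
    using H' by (simp_all add: card_image_face)
  have "G \<in> cofaces D F'" if "F' \<subseteq> G" "card F' = card F" for F'
    using that G(1) GF(2) finite_in_D[OF G(1)] by (auto simp: cofaces_def)
  then have "G \<in> cofaces D F \<or> F = A \<and> G \<in> cofaces D B \<or> F = B \<and> G \<in> cofaces D A"
    using lift_subset[OF F(1) G(1) F(2) GF(1)] glued_faces(3,4) by (elim disjE conjE) simp_all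
  with G(2) show thesis
    by (rule that)
qed

lemma cofaces_image:
  assumes "F \<in> D" "Suc i \<le> card F" "F \<noteq> A" "F \<noteq> B"
  shows "cofaces K (g ` F) = image g ` cofaces D F"
  using image_cofaces_subset[OF assms(1)] assms(3,4) by (auto elim!: cofaces_lift[OF assms(1,2)])

lemma cofaces_glued: "cofaces K (g ` A) = image g ` (cofaces D A \<union> cofaces D B)"
proof
  show "cofaces K (g ` A) \<subseteq> image g ` (cofaces D A \<union> cofaces D B)"
    using glued_faces by (auto elim!: cofaces_lift[of A])
  show "image g ` (cofaces D A \<union> cofaces D B) \<subseteq> cofaces K (g ` A)"
    using image_cofaces_subset[OF glued_faces(1)] image_cofaces_subset[OF glued_faces(2)] gA_eq_gB by (simp add: image_Un)
qed

lemma inj_on_cofaces: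
  "Suc i \<le> card F \<Longrightarrow> Suc i \<le> card G \<Longrightarrow> inj_on (image g) (cofaces D F \<union> cofaces D G)"
  by (rule inj_on_subset[OF inj_on_image_large]) (auto simp: cofaces_def)

text \<open>Induction from the facets downwards: cofaces of \<open>F\<close> have at least i+2
  vertices, so they are neither \<open>A\<close> nor \<open>B\<close>, and \<open>g\<close> maps
  them bijectively to the cofaces of the image.\<close>

lemma normalized_weight_image:
  assumes "F \<in> D" "Suc i \<le> card F" "F \<noteq> A" "F \<noteq> B"
  shows "normalized_weight K (g ` F) = normalized_weight D F"
  using assms
proof (induction F rule: measure_induct_rule[where f = "\<lambda>F. card {H \<in> D. F \<subset> H}"])
  case (less F)
  have "normalized_weight K (g ` G) = normalized_weight D G" if "G \<in> cofaces D F" for G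
  proof -
    have "G \<noteq> A" "G \<noteq> B"
      using that less.prems(2) glued_faces(3,4) by (auto simp: cofaces_def)
    then show ?thesis
      using less.IH[OF cofaces_measure[OF finite_D that]] that less.prems(2) by (simp add: cofaces_def)
  qed
  moreover have "g ` F \<in> K"
    using less.prems by (simp add: K_eq)
  moreover have "inj_on (image g) (cofaces D F)"
    using inj_on_cofaces[of F F] less.prems by simp
  ultimately show ?case
    using less.prems
    by (simp add: normalized_weight_cofaces[OF complex_K] normalized_weight_cofaces[OF complex_D]
        cofaces_image sum.reindex)
qed

lemma normalized_weight_image_cofaces:
  assumes "G \<in> cofaces D F" "Suc i \<le> card F"
  shows "normalized_weight K (g ` G) = normalized_weight D G"
  using assms glued_faces(3,4) by (intro normalized_weight_image) (auto simp: cofaces_def)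

text \<open>The cofaces of the glued face come from the disjoint cofaces of \<open>A\<close> and of
  \<open>B\<close>. A facet contributes an empty sum here although its own weight is 1, whence the
  cases; if both are facets, the first case gives the weight 1 of the new facet.\<close>

lemma normalized_weight_glued:
  "normalized_weight K (g ` A) =
    (if cofaces D A = {} then normalized_weight D B
     else if cofaces D B = {} then normalized_weight D A
     else normalized_weight D A + normalized_weight D B)"
proof -
  have sum: "(\<Sum>H\<in>image g ` (cofaces D A \<union> cofaces D B). normalized_weight K H)
      = (\<Sum>G\<in>cofaces D A \<union> cofaces D B. normalized_weight D G)"
    using inj_on_cofaces[of A B] glued_faces(3,4) normalized_weight_image_cofaces[of _ A]
      normalized_weight_image_cofaces[of _ B]
    by (simp add: sum.reindex) (rule sum.cong[OF refl], blast)
  have "cofaces D A \<inter> cofaces D B = {}"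
    using no_common_coface by (auto simp: cofaces_def)
  then have "(\<Sum>G\<in>cofaces D A \<union> cofaces D B. normalized_weight D G)
      = (\<Sum>G\<in>cofaces D A. normalized_weight D G) + (\<Sum>G\<in>cofaces D B. normalized_weight D G)"
    by (simp add: sum.union_disjoint finite_cofaces finite_D)
  moreover have "g ` A \<in> K"
    using glued_faces by (simp add: K_eq)
  ultimately show ?thesis
    using glued_faces sum by (cases "cofaces D A = {}"; cases "cofaces D B = {}")
      (simp_all add: normalized_weight_cofaces[OF complex_K] cofaces_glued
        normalized_weight_cofaces[OF complex_D])
qed

text \<open>If both \<open>A\<close> and \<open>B\<close> are facets, only \<open>A\<close> is
  dropped: the weight 1 of \<open>B\<close> then accounts for the weight 1 of the glued
  facet.\<close>

definition dropped :: "'a set set" where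
  "dropped = (if cofaces D A = {} then {A} else if cofaces D B = {} then {B} else {})"

text \<open>The restriction to orderings of faces of \<open>D\<close> matters: a list mixing
  vertices of \<open>A\<close> and \<open>B\<close> can be mapped to an ordered face of
  \<open>K\<close> without being a face of \<open>D\<close>.\<close>

definition pullback :: "('c list \<Rightarrow> real) \<Rightarrow> 'a list \<Rightarrow> real" where
  "pullback f l = (if l \<in> ordered_faces i D \<and> set l \<notin> dropped then f (map g l) else 0)"

section \<open>The pullback as an isometric embedding of codimension 1\<close>

lemma pullback_add: "pullback (f + h) = pullback f + pullback h"
  by (rule ext) (simp add: pullback_def)

lemma pullback_scale: "pullback (fun_scale c f) = fun_scale c (pullback f)"
  by (rule ext) (simp add: pullback_def fun_scale_def)

lemma map_ordered_faces: "l \<in> ordered_faces j D \<Longrightarrow> map g l \<in> ordered_faces j K"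
  by (auto simp: ordered_faces_def faces_def distinct_map inj_face card_image_face K_eq)

lemma pullback_in_cochains:
  assumes f: "f \<in> cochains i K"
  shows "pullback f \<in> cochains i D"
  unfolding cochains_def
proof (intro CollectI conjI allI impI ballI)
  fix l p assume l: "l \<in> ordered_faces i D" and p: "p permutes {..<length l}"
  have "f (map g (permute_list p l)) = of_int (sign p) * f (map g l)"
    using cochains_permute[OF f map_ordered_faces[OF l], of p] p by (simp add: permute_list_map)
  moreover have "permute_list p l \<in> ordered_faces i D"
    using l p by (simp add: ordered_faces_def)
  ultimately show "pullback f (permute_list p l) = of_int (sign p) * pullback f l"
    using l p by (simp add: pullback_def)
qed (simp add: pullback_def)

lemma image_faces: "image g ` faces j D = faces j K"
proof
  show "image g ` faces j D \<subseteq> faces j K"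
    by (auto simp: faces_def card_image_face K_eq)
  show "faces j K \<subseteq> image g ` faces j D"
  proof
    fix H assume "H \<in> faces j K"
    then obtain F where F: "F \<in> D" "H = g ` F" "card H = Suc j"
      by (auto simp: faces_def K_eq)
    then have "F \<in> faces j D"
      by (simp add: faces_def finite_in_D card_image_face)
    then show "H \<in> image g ` faces j D"
      using F(2) by blast
  qed
qed

lemma faces_image_eqD:
  "F \<in> faces i D \<Longrightarrow> G \<in> faces i D \<Longrightarrow> g ` F = g ` G \<Longrightarrow> F = G \<or> F = A \<and> G = B \<or> F = B \<and> G = A"
  using image_eqD by (auto simp: faces_def)

text \<open>Omitting \<open>B\<close> loses no image, because \<open>A\<close> has the same one, and
  makes the map on i-faces injective.\<close>

lemma card_faces: "card (faces i D) = Suc (card (faces i K))"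
proof -
  have "g ` B \<in> image g ` (faces i D - {B})"
    using A_face gA_eq_gB glued_faces by (intro image_eqI[of _ _ A]) auto
  then have "faces i K = image g ` (faces i D - {B})"
    unfolding image_faces[symmetric] using B_face by blast
  moreover have "inj_on (image g) (faces i D - {B})"
    using faces_image_eqD by (intro inj_onI) blast
  ultimately have "card (faces i K) = card (faces i D - {B})"
    by (simp add: card_image)
  then show ?thesis
    using card_Suc_Diff1[OF finite_faces[OF finite_D] B_face] by simp
qed

text \<open>The identity that dictates \<open>dropped\<close>. The fibre over the glued face is
  \<open>{A, B}\<close>; every other fibre is a single face of unchanged weight.\<close>

lemma sum_fiber:
  assumes H: "H \<in> faces i K"
  shows "(\<Sum>F | F \<in> faces i D \<and> g ` F = H. if F \<in> dropped then 0 else normalized_weight D F)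
    = normalized_weight K H"
proof (cases "H = g ` A")
  case True
  have fiber: "{F \<in> faces i D. g ` F = H} = {A, B}"
    using True faces_image_eqD[OF _ A_face] A_face B_face gA_eq_gB by auto
  show ?thesis
    unfolding fiber unfolding True normalized_weight_glued dropped_def using glued_faces
    by (simp add: normalized_weight_cofaces[OF complex_D])
next
  case False
  obtain F where F: "F \<in> faces i D" "H = g ` F"
    using H image_faces by blast
  then have F_ne: "F \<noteq> A" "F \<noteq> B"
    using False gA_eq_gB by auto
  then have fiber: "{F' \<in> faces i D. g ` F' = H} = {F}"
    using F faces_image_eqD[OF _ F(1)] by auto
  have "normalized_weight K (g ` F) = normalized_weight D F"
    using F(1) F_ne by (intro normalized_weight_image) (auto simp: faces_def)
  then show ?thesis
    unfolding fiber using F_ne F(2) by (auto simp: dropped_def)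
qed

lemma inner_pullback:
  assumes f: "f \<in> cochains i K"
  shows "cochain_inner i D (normalized_weight D) (pullback f) (pullback f)
    = cochain_inner i K (normalized_weight K) f f"
proof -
  let ?h = "\<lambda>H. f (orient H) * f (orient H)"
  let ?c = "\<lambda>F. if F \<in> dropped then 0 else normalized_weight D F"
  have "normalized_weight D F * pullback f (orient F) * pullback f (orient F) = ?c F * ?h (g ` F)"
    if F: "F \<in> faces i D" for F
  proof -
    have l: "orient F \<in> ordered_faces i D" "set (orient F) = F"
      using F by (simp_all add: orient_ordered_faces set_orient finite_face)
    have "g ` F \<in> faces i K"
      using F image_faces by blast
    then have "f (map g (orient F)) * f (map g (orient F)) = ?h (g ` F)"
      using cochains_prod_orientation[OF f f map_ordered_faces[OF l(1)], of "orient (g ` F)"] l(2)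
      by (simp add: distinct_orient set_orient finite_face)
    then show ?thesis
      using l by (simp add: pullback_def mult.assoc)
  qed
  then have "cochain_inner i D (normalized_weight D) (pullback f) (pullback f)
      = (\<Sum>F\<in>faces i D. ?c F * ?h (g ` F))"
    unfolding cochain_inner_def by (intro sum.cong refl)
  \<comment> \<open>Faces of \<open>D\<close> are grouped by their image; \<open>?h\<close> is
    constant on a fibre, so only the total weight of the fibre counts.\<close>
  also have "\<dots> = (\<Sum>H\<in>faces i K. \<Sum>F | F \<in> faces i D \<and> g ` F = H. ?c F * ?h (g ` F))"
    by (rule sum.group[symmetric]) (simp_all add: finite_faces finite_D finite_K image_faces)
  also have "\<dots> = (\<Sum>H\<in>faces i K. (\<Sum>F | F \<in> faces i D \<and> g ` F = H. ?c F) * ?h H)"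
    unfolding sum_distrib_right by (intro sum.cong) auto
  also have "\<dots> = cochain_inner i K (normalized_weight K) f f"
    unfolding cochain_inner_def by (intro sum.cong refl) (simp only: sum_fiber mult.assoc)
  finally show ?thesis .
qed

text \<open>Deleting a vertex commutes with \<open>map g\<close>, and the remaining face has
  \<open>set l\<close> as a coface, whereas members of \<open>dropped\<close> have none.\<close>

lemma coboundary_pullback:
  assumes l: "l \<in> ordered_faces (Suc i) D"
  shows "coboundary i D (pullback f) l = coboundary i K f (map g l)"
proof -
  have len: "length l = Suc (Suc i)"
    using length_ordered_faces[OF l] .
  have lD: "distinct l" "set l \<in> D"
    using l by (auto simp: ordered_faces_def faces_def)
  have "pullback f (take j l @ drop (Suc j) l) = f (take j (map g l) @ drop (Suc j) (map g l))"
    if "j \<le> Suc i" for j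
  proof -
    let ?d = "take j l @ drop (Suc j) l"
    have split: "l = take j l @ l ! j # drop (Suc j) l"
      using that len by (simp add: id_take_nth_drop)
    have "distinct ?d"
      using lD(1) by (subst (asm) split) auto
    moreover have sub: "set ?d \<subseteq> set l"
      using set_take_subset[of j l] set_drop_subset[of "Suc j" l] by auto
    moreover have "length ?d = Suc i"
      using that len by simp
    ultimately have d: "?d \<in> ordered_faces i D" "card (set ?d) = Suc i"
      using D_closed[OF lD(2)] distinct_card[of ?d] by (auto simp: ordered_faces_def faces_def)
    have "card (set l) = Suc (Suc i)"
      using lD(1) len by (simp add: distinct_card)
    then have "set l \<in> cofaces D (set ?d)"
      using lD(2) d(2) sub by (auto simp: cofaces_def)
    then have "set ?d \<notin> dropped"
      by (auto simp: dropped_def split: if_splits)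
    then show ?thesis
      using d(1) by (simp add: pullback_def take_map drop_map)
  qed
  then show ?thesis
    using l map_ordered_faces[OF l] by (simp add: coboundary_def del: sum.atMost_Suc)
qed

text \<open>On (i+1)-faces \<open>g\<close> induces a weight-preserving bijection. Chosen
  orientations need not correspond, but only squares are summed.\<close>

lemma inner_coboundary_pullback:
  assumes f: "f \<in> cochains i K"
  shows "cochain_inner (Suc i) D (normalized_weight D) (coboundary i D (pullback f)) (coboundary i D (pullback f))
    = cochain_inner (Suc i) K (normalized_weight K) (coboundary i K f) (coboundary i K f)"
proof -
  let ?F = "faces (Suc i)"
  have "inj_on (image g) (?F D)"
    by (rule inj_on_subset[OF inj_on_image_large]) (auto simp: faces_def)
  then have "cochain_inner (Suc i) K (normalized_weight K) (coboundary i K f) (coboundary i K f)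
      = (\<Sum>G\<in>?F D. normalized_weight K (g ` G) * (coboundary i K f (orient (g ` G)))\<^sup>2)"
    unfolding cochain_inner_def image_faces[of "Suc i", symmetric]
    by (simp add: sum.reindex power2_eq_square mult.assoc)
  also have "\<dots> = (\<Sum>G\<in>?F D. normalized_weight D G * (coboundary i D (pullback f) (orient G))\<^sup>2)"
  proof (rule sum.cong[OF refl])
    fix G assume G: "G \<in> ?F D"
    have l: "orient G \<in> ordered_faces (Suc i) D" "set (orient G) = G" "finite G"
      using G by (simp_all add: orient_ordered_faces set_orient finite_face)
    have "(coboundary i K f (map g (orient G)))\<^sup>2 = (coboundary i K f (orient (g ` G)))\<^sup>2"
      using l map_ordered_faces[OF l(1)]
      by (intro coboundary_square_orientation[OF f]) (auto simp: ordered_faces_def distinct_orient set_orient)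
    moreover have "normalized_weight K (g ` G) = normalized_weight D G"
      using G glued_faces by (intro normalized_weight_image) (auto simp: faces_def)
    ultimately show "normalized_weight K (g ` G) * (coboundary i K f (orient (g ` G)))\<^sup>2
        = normalized_weight D G * (coboundary i D (pullback f) (orient G))\<^sup>2"
      by (simp add: coboundary_pullback[OF l(1)])
  qed
  finally show ?thesis
    by (simp add: cochain_inner_def power2_eq_square mult.assoc)
qed

lemma up_spectrum_interlacing:
  shows "length (up_spectrum i D) = card (faces i D)" and "length (up_spectrum i K) = card (faces i K)"
    and "j < card (faces i K) \<Longrightarrow> up_spectrum i D ! j \<le> up_spectrum i K ! j \<and>
      up_spectrum i K ! j \<le> up_spectrum i D ! Suc j"
proof -
  have posD: "0 < normalized_weight D F" if "F \<in> faces i D" for F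
    using normalized_weight_pos[OF complex_D] that by (simp add: faces_def)
  have posK: "0 < normalized_weight K F" if "F \<in> faces i K" for F
    using normalized_weight_pos[OF complex_K] that by (simp add: faces_def)
  have opD: "symmetric_operator (cochains i D) (cochain_inner i D (normalized_weight D))
      (normalized_up_laplacian i D)"
    unfolding normalized_up_laplacian_def by (rule symmetric_operator_up_laplacian[OF finite_D posD])
  have opK: "symmetric_operator (cochains i K) (cochain_inner i K (normalized_weight K))
      (normalized_up_laplacian i K)"
    unfolding normalized_up_laplacian_def by (rule symmetric_operator_up_laplacian[OF finite_K posK])
  have form: "cochain_inner i D (normalized_weight D) (pullback f) (normalized_up_laplacian i D (pullback f))
      = cochain_inner i K (normalized_weight K) f (normalized_up_laplacian i K f)"
    if "f \<in> cochains i K" for f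
    unfolding normalized_up_laplacian_def
    by (simp add: cochain_inner_up_laplacian[OF finite_D posD pullback_in_cochains[OF that]]
        cochain_inner_up_laplacian[OF finite_K posK that] inner_coboundary_pullback[OF that])
  have card: "card (unit_cochain ` faces i D) = Suc (card (unit_cochain ` faces i K))"
    using card_faces by (simp add: card_image inj_on_unit_cochain)
  note interlacing = eigenvalue_interlacing[OF opK opD pullback_add pullback_scale pullback_in_cochains
      inner_pullback form independent_unit_cochains[OF finite_K] span_unit_cochains[OF finite_K]
      independent_unit_cochains[OF finite_D] span_unit_cochains[OF finite_D] card]
  show "length (up_spectrum i D) = card (faces i D)" "length (up_spectrum i K) = card (faces i K)"
    using interlacing(1,2) by (simp_all add: up_spectrum_def card_image inj_on_unit_cochain)
  show "up_spectrum i D ! j \<le> up_spectrum i K ! j \<and> up_spectrum i K ! j \<le> up_spectrum i D ! Suc j"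
    if "j < card (faces i K)"
    using interlacing(3)[of j] that by (simp add: up_spectrum_def card_image inj_on_unit_cochain)
qed

end

section \<open>The wedge sum\<close>

lemma glue_Inl [simp]: "glue vs us (Inl a) = Inl a"
  by (simp add: glue_def)

context
  fixes vs :: "'a list" and us :: "'b list"
  assumes distinct_vs: "distinct vs" and distinct_us: "distinct us" and len: "length vs = length us"
begin

lemma glue_Inr_nth: "j < length us \<Longrightarrow> glue vs us (Inr (us ! j)) = Inl (vs ! j)"
  using map_of_zip_nth[of us vs j] len distinct_us by (simp add: glue_def)

lemma glue_Inr_notin: "b \<notin> set us \<Longrightarrow> glue vs us (Inr b) = Inr b"
  using map_of_zip_is_None[of us vs b] len by (simp add: glue_def split: option.split)

text \<open>Vertices in \<open>us\<close> go to distinct vertices of the left summand, and all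
  others stay in the right one.\<close>

lemma inj_glue_Inr: "inj_on (glue vs us) (range Inr)"
proof (rule inj_onI)
  fix x y :: "'a + 'b" assume "x \<in> range Inr" "y \<in> range Inr" "glue vs us x = glue vs us y"
  then obtain b c where bc: "x = Inr b" "y = Inr c" "glue vs us (Inr b) = glue vs us (Inr c)"
    by blast
  show "x = y"
  proof (cases "b \<in> set us"; cases "c \<in> set us")
    assume "b \<in> set us" "c \<in> set us"
    then show ?thesis
      using bc distinct_vs len by (auto simp: in_set_conv_nth glue_Inr_nth nth_eq_iff_index_eq)
  qed (use bc in \<open>auto simp: in_set_conv_nth[of _ us] glue_Inr_nth glue_Inr_notin\<close>)
qed

lemma glue_Inr_eq_InlD: "glue vs us (Inr b) = Inl a \<Longrightarrow> a \<in> set vs \<and> b \<in> set us"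
  using len by (cases "b \<in> set us") (auto simp: in_set_conv_nth[of b] glue_Inr_nth glue_Inr_notin)

lemma glue_image_us: "glue vs us ` Inr ` set us = Inl ` set vs"
proof -
  have "map (glue vs us) (map Inr us) = map Inl vs"
    using len by (intro nth_equalityI) (simp_all add: glue_Inr_nth)
  then show ?thesis
    by (metis image_set)
qed

end

lemma finite_abstract_complex_disjoint_union:
  assumes "finite_abstract_complex K1" "finite_abstract_complex K2"
  shows "finite_abstract_complex (disjoint_union K1 K2)"
  using assms unfolding finite_abstract_complex_def disjoint_union_def
  by (auto simp: subset_image_iff)

text \<open>Within one summand \<open>glue vs us\<close> is injective, so inclusions lift. Across
  the summands, an inclusion of images confines the smaller face to the shared vertices; there are
  only i+1 of these, so a face with at least i+1 vertices must be the whole glued face.\<close>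

lemma face_gluing_wedge_sum:
  fixes K1 :: "'a set set" and K2 :: "'b set set"
  assumes K1: "finite_abstract_complex K1" and K2: "finite_abstract_complex K2"
    and vs: "vs \<in> ordered_faces i K1" and us: "us \<in> ordered_faces i K2"
  shows "face_gluing (disjoint_union K1 K2) (wedge_sum vs us K1 K2) (glue vs us)
    (Inl ` set vs) (Inr ` set us) i"
proof
  let ?g = "glue vs us" and ?D = "disjoint_union K1 K2"
  have dist: "distinct vs" "distinct us" "length vs = length us"
    using vs us length_ordered_faces[OF vs] length_ordered_faces[OF us] by (auto simp: ordered_faces_def)
  note inj = inj_glue_Inr[OF dist]
  have Inr_subset: "F \<subseteq> G" if "?g ` F \<subseteq> ?g ` G" "F \<subseteq> range Inr" "G \<subseteq> range Inr" for F G
    using that inj_on_image_mem_iff[OF inj] by blast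
  note InlD = glue_Inr_eq_InlD[OF dist] and us_vs = glue_image_us[OF dist]
  have card_vs: "card (set vs) = Suc i" "card (set us) = Suc i"
    using vs us by (auto simp: ordered_faces_def faces_def)
  show "finite_abstract_complex ?D"
    using K1 K2 by (rule finite_abstract_complex_disjoint_union)
  show "wedge_sum vs us K1 K2 = image ?g ` ?D"
    by (simp add: wedge_sum_def)
  show "inj_on ?g F" if "F \<in> ?D" for F
    using that inj_onD[OF inj] by (auto simp: disjoint_union_def intro!: inj_onI)
  show "Inl ` set vs \<in> faces i ?D" "Inr ` set us \<in> faces i ?D"
    using vs us by (auto simp: ordered_faces_def faces_def disjoint_union_def card_image)
  show "?g ` Inl ` set vs = ?g ` Inr ` set us"
    unfolding us_vs by (simp add: image_image)
  \<comment> \<open>The glued faces are nonempty and lie in different summands, while a face of the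
    union lies in one.\<close>
  obtain a b where "a \<in> set vs" "b \<in> set us"
    using card_vs by fastforce
  then show "\<not> Inr ` set us \<subseteq> G" if "G \<in> ?D" "Inl ` set vs \<subseteq> G" for G
    using that by (auto simp: disjoint_union_def)
  fix F G assume F: "F \<in> ?D" and G: "G \<in> ?D" and card: "Suc i \<le> card F" and sub: "?g ` F \<subseteq> ?g ` G"
  consider (ll) F' G' where "F = Inl ` F'" "G = Inl ` G'"
    | (lr) F' G' where "F = Inl ` F'" "G = Inr ` G'"
    | (rl) F' G' where "F = Inr ` F'" "G = Inl ` G'"
    | (rr) F' G' where "F = Inr ` F'" "G = Inr ` G'"
    using F G by (auto simp: disjoint_union_def)
  then show "F \<subseteq> G \<or> F = Inl ` set vs \<and> Inr ` set us \<subseteq> G \<or> F = Inr ` set us \<and> Inl ` set vs \<subseteq> G"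
  proof cases
    case ll
    then show ?thesis
      using sub by (simp add: image_image)
  next
    case rr
    then have "F \<subseteq> G"
      using sub Inr_subset[of F G] by auto
    then show ?thesis ..
  next
    case lr
    have "F' \<subseteq> set vs"
    proof
      fix a assume "a \<in> F'"
      then have "Inl a \<in> ?g ` G"
        using sub lr by force
      then show "a \<in> set vs"
        using lr InlD by auto
    qed
    moreover have "card F' = card F"
      using lr by (simp add: card_image)
    ultimately have "F' = set vs"
      using card card_vs card_seteq[of "set vs" F'] by simp
    moreover from this have "?g ` Inr ` set us \<subseteq> ?g ` G"
      unfolding us_vs using sub lr by (simp add: image_image)
    then have "Inr ` set us \<subseteq> G"
      using lr Inr_subset[of "Inr ` set us" G] by auto
    ultimately show ?thesis
      using lr by blast
  next
    case rl
    have "F' \<subseteq> set us"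
    proof
      fix b assume "b \<in> F'"
      then have "?g (Inr b) \<in> ?g ` Inl ` G'"
        using sub rl by blast
      then show "b \<in> set us"
        using InlD by auto
    qed
    moreover have "card F' = card F"
      using rl by (simp add: card_image)
    ultimately have "F' = set us"
      using card card_vs card_seteq[of "set us" F'] by simp
    then show ?thesis
      using sub rl us_vs by (simp add: image_image)
  qed
qed

theorem theorem6p4:
  fixes K1 :: "'a set set" and K2 :: "'b set set"
    and i m :: nat and vs :: "'a list" and us :: "'b list"
    and K :: "('a + 'b) set set" and mu lam :: "real list"
  assumes "finite_abstract_complex K1" and "finite_abstract_complex K2"
    and "faces i K1 \<noteq> {}" and "faces i K2 \<noteq> {}"
    and "vs \<in> ordered_faces i K1" and "us \<in> ordered_faces i K2"
    and "K = wedge_sum vs us K1 K2"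
    and "mu = up_spectrum i (disjoint_union K1 K2)"
    and "lam = up_spectrum i K"
    and "m = card (faces i (disjoint_union K1 K2))"
  shows "length mu = m \<and> length lam = m - 1 \<and>
    (\<forall>j\<in>{1..m - 1}. mu ! (j - 1) \<le> lam ! (j - 1) \<and> lam ! (j - 1) \<le> mu ! j)"
proof -
  interpret face_gluing "disjoint_union K1 K2" K "glue vs us" "Inl ` set vs" "Inr ` set us" i
    unfolding assms(7) by (rule face_gluing_wedge_sum[OF assms(1,2,5,6)])
  have "card (faces i K) = m - 1"
    using card_faces assms(10) by simp
  moreover have "mu ! (j - 1) \<le> lam ! (j - 1) \<and> lam ! (j - 1) \<le> mu ! j" if "j \<in> {1..m - 1}" for j
  proof -
    \<comment> \<open>Eigenvalues are numbered from 1 but list positions from 0, and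
      \<open>j \<ge> 1\<close> keeps the subtraction exact.\<close>
    have "j - 1 < card (faces i K)" "Suc (j - 1) = j"
      using that calculation by auto
    then show ?thesis
      using up_spectrum_interlacing(3)[of "j - 1"] assms(8,9) by simp
  qed
  ultimately show ?thesis
    using up_spectrum_interlacing(1,2) assms(8-10) by simp
qed

end
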